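(* Let $d \ge 1$, and let $P, P_1, P_2, P_3, \ldots$ be probability measures in $\mathcal{P}_d^{(\mathrm{lc})}$ with densities $f, f_1, f_2, f_3, \ldots$, respectively, such that $P_n \to P$ weakly as $n \to \infty$. Let $\Theta(P)$ be the set of all $\theta \in \mathbb{R}^d$ such that $\int \exp(\theta^\top x)\, P(dx) < \infty$. Then for any $\theta \in \Theta(P)$ and arbitrary $d$-variate polynomials $\Pi : \mathbb{R}^d \to \mathbb{R}$, the integral $\int_{\mathbb{R}^d} \exp(\theta^\top x) |\Pi(x)| f(x)\, dx$ is finite and $$\lim_{n\to\infty} \int_{\mathbb{R}^d} \exp(\theta^\top x) |\Pi(x)| \, |f_n(x) - f(x)| \, dx = 0.$$ Moreover, for any $\theta \in \mathbb{R}^d \setminus \Theta(P)$, $$\lim_{n\to\infty} \int_{\mathbb{R}^d} \exp(\theta^\top x) f_n(x)\, dx = \infty.$$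
   Context: $\mathcal{P}_d^{(\mathrm{lc})}$ denotes the set of all log-concave probability distributions on $\mathbb{R}^d$, i.e. all probability measures admitting a Lebesgue density of the form $f(x) = \exp(\varphi(x))$ for some concave function $\varphi : \mathbb{R}^d \to [-\infty,\infty)$ (with $\exp(-\infty) = 0$). "The density" of such a measure always means a density of this form. *)

theory Defs
  imports "HOL-Probability.Probability"
begin

text \<open>Concavity of a function with values in \<open>[-\<infinity>, \<infinity>)\<close>. As the value \<open>\<infinity>\<close> is excluded,
  the sum on the left-hand side is never of the form \<open>\<infinity> - \<infinity>\<close>.\<close>

definition ext_concave :: "('a::real_vector \<Rightarrow> ereal) \<Rightarrow> bool" where
  "ext_concave \<phi> \<longleftrightarrow> (\<forall>x. \<phi> x < \<infinity>) \<and>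
     (\<forall>x y. \<forall>t::real. 0 < t \<and> t < 1 \<longrightarrow>
        ereal (1 - t) * \<phi> x + ereal t * \<phi> y \<le> \<phi> ((1 - t) *\<^sub>R x + t *\<^sub>R y))"

text \<open>The value at \<open>\<infinity>\<close> is junk and never used.\<close>

definition ext_exp :: "ereal \<Rightarrow> real" where
  "ext_exp y = (if y = -\<infinity> then 0 else exp (real_of_ereal y))"

definition log_concave :: "('a::real_vector \<Rightarrow> real) \<Rightarrow> bool" where
  "log_concave f \<longleftrightarrow> (\<exists>\<phi>. ext_concave \<phi> \<and> (\<forall>x. f x = ext_exp (\<phi> x)))"

text \<open>A log-concave function is Lebesgue measurable but not necessarily Borel measurable (its
  values on the boundary of its support can be irregular), so densities of Borel measures
  are taken with respect to \<^const>\<open>lebesgue\<close> rather than \<^const>\<open>lborel\<close>.\<close>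

definition lebesgue_density :: "'a::euclidean_space measure \<Rightarrow> ('a \<Rightarrow> real) \<Rightarrow> bool" where
  "lebesgue_density P f \<longleftrightarrow> f \<in> borel_measurable lebesgue \<and> (\<forall>x. 0 \<le> f x) \<and>
     (\<forall>A\<in>sets borel. emeasure P A = (\<integral>\<^sup>+x\<in>A. ennreal (f x) \<partial>lebesgue))"

definition lc_density :: "'a::euclidean_space measure \<Rightarrow> ('a \<Rightarrow> real) \<Rightarrow> bool" where
  "lc_density P f \<longleftrightarrow> lebesgue_density P f \<and> log_concave f"

definition lc_measures :: "'a::euclidean_space measure set" where
  "lc_measures = {P. prob_space P \<and> sets P = sets borel \<and> (\<exists>f. lc_density P f)}"

definition converges_weakly ::
  "(nat \<Rightarrow> 'a::topological_space measure) \<Rightarrow> 'a measure \<Rightarrow> bool" where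
  "converges_weakly Q P \<longleftrightarrow>
     (\<forall>g::'a \<Rightarrow> real. continuous_on UNIV g \<and> bounded (range g) \<longrightarrow>
        (\<lambda>n. \<integral>x. g x \<partial>Q n) \<longlonglongrightarrow> (\<integral>x. g x \<partial>P))"

definition exp_moment_set :: "'a::euclidean_space measure \<Rightarrow> 'a set" where
  "exp_moment_set P = {\<theta>. (\<integral>\<^sup>+x. ennreal (exp (\<theta> \<bullet> x)) \<partial>P) < \<infinity>}"

end

theory Submission
  imports Defs
begin

text \<open>Superlevel sets of a log-concave function are convex. A weak limit therefore controls the densities
  pointwise: averages over small balls surrounding \<open>x\<close> bound \<open>f\<^sub>n x\<close> from below, and if \<open>f\<^sub>n x\<close> is large
  then, by log-concavity along segments towards a ball on which \<open>f\<^sub>n\<close> is bounded below, so is an average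
  near \<open>x\<close>. Hence \<open>f\<^sub>n\<close> converges to \<open>f\<close> off the boundary of the support of \<open>f\<close>, a null set. For
  \<open>\<theta>\<close> outside \<open>\<Theta>(P)\<close>, Fatou's lemma concludes.

  For \<open>\<theta>\<close> in \<open>\<Theta>(P)\<close>, the tilted densities \<open>g\<^sub>n x = exp (\<theta> \<bullet> x) f\<^sub>n x\<close> are log-concave and converge to an
  integrable limit. They are eventually at least some \<open>\<delta>\<close> on a ball around some \<open>x\<^sub>0\<close> and at most \<open>\<delta> / e\<close> on a
  large sphere around \<open>x\<^sub>0\<close>, because their mass on a far annulus is small. Log-concavity along rays from \<open>x\<^sub>0\<close> then
  yields a common envelope \<open>C exp (- c dist x\<^sub>0 x)\<close>, and dominated convergence applies, polynomial
  factors included.\<close>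

section \<open>Log-concavity: multiplicative form, superlevel sets, continuity\<close>

text \<open>Exponentiating the concavity inequality gives a form with weighted geometric means,
  which avoids extended reals from here on. The value -infinity corresponds to 0, and
  \<open>0 powr s = 0\<close> makes the product on the left vanish. Conversely,
  \<open>\<phi>\<close> is the logarithm of \<open>f\<close>, set to -infinity at the zeros of
  \<open>f\<close>.\<close>

lemma log_concave_iff:
  "log_concave f \<longleftrightarrow> (\<forall>x. 0 \<le> f x) \<and>
    (\<forall>x y t. 0 < t \<and> t < 1 \<longrightarrow> f x powr (1 - t) * f y powr t \<le> f ((1 - t) *\<^sub>R x + t *\<^sub>R y))"
proof
  assume "log_concave f"
  then obtain \<phi> where \<phi>: "ext_concave \<phi>" and f: "\<And>x. f x = ext_exp (\<phi> x)"
    unfolding log_concave_def by blast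
  have fin: "\<phi> x < \<infinity>" for x
    using \<phi> unfolding ext_concave_def by blast
  have "f x powr (1 - t) * f y powr t \<le> f ((1 - t) *\<^sub>R x + t *\<^sub>R y)" if t: "0 < t" "t < 1" for x y t
  proof (cases "\<phi> x = -\<infinity> \<or> \<phi> y = -\<infinity>")
    case True
    then show ?thesis by (auto simp: f ext_exp_def)
  next
    case False
    then obtain a b where ab: "\<phi> x = ereal a" "\<phi> y = ereal b"
      using fin[of x] fin[of y] by (cases "\<phi> x"; cases "\<phi> y") auto
    have *: "ereal ((1 - t) * a + t * b) \<le> \<phi> ((1 - t) *\<^sub>R x + t *\<^sub>R y)"
      using \<phi> t ab unfolding ext_concave_def
      by (metis plus_ereal.simps(1) times_ereal.simps(1))
    then obtain c where c: "\<phi> ((1 - t) *\<^sub>R x + t *\<^sub>R y) = ereal c"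
      using fin[of "(1 - t) *\<^sub>R x + t *\<^sub>R y"] by (cases "\<phi> ((1 - t) *\<^sub>R x + t *\<^sub>R y)") auto
    have "exp a powr (1 - t) * exp b powr t = exp ((1 - t) * a + t * b)"
      by (simp add: powr_def exp_add)
    then show ?thesis using * c ab by (simp add: f ext_exp_def)
  qed
  then show "(\<forall>x. 0 \<le> f x) \<and>
    (\<forall>x y t. 0 < t \<and> t < 1 \<longrightarrow> f x powr (1 - t) * f y powr t \<le> f ((1 - t) *\<^sub>R x + t *\<^sub>R y))"
    by (auto simp: f ext_exp_def)
next
  assume *: "(\<forall>x. 0 \<le> f x) \<and>
    (\<forall>x y t. 0 < t \<and> t < 1 \<longrightarrow> f x powr (1 - t) * f y powr t \<le> f ((1 - t) *\<^sub>R x + t *\<^sub>R y))"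
  define \<phi> where "\<phi> x = (if f x = 0 then -\<infinity> else ereal (ln (f x)))" for x
  have "ereal (1 - t) * \<phi> x + ereal t * \<phi> y \<le> \<phi> ((1 - t) *\<^sub>R x + t *\<^sub>R y)"
    if t: "0 < t" "t < 1" for x y t
  proof (cases "f x = 0 \<or> f y = 0")
    case True
    then have eq: "ereal (1 - t) * \<phi> x + ereal t * \<phi> y = -\<infinity>"
      using t unfolding \<phi>_def by (cases "f x = 0"; cases "f y = 0") simp_all
    show ?thesis unfolding eq by simp
  next
    case False
    then have pos: "0 < f x" "0 < f y" using * by (metis order_le_less)+
    then have "0 < f x powr (1 - t) * f y powr t" by simp
    moreover have le: "f x powr (1 - t) * f y powr t \<le> f ((1 - t) *\<^sub>R x + t *\<^sub>R y)"
      using * t by blast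
    ultimately have "ln (f x powr (1 - t) * f y powr t) \<le> ln (f ((1 - t) *\<^sub>R x + t *\<^sub>R y))"
      "0 < f ((1 - t) *\<^sub>R x + t *\<^sub>R y)"
      by auto
    then show ?thesis using pos by (simp add: \<phi>_def ln_mult ln_powr)
  qed
  then have "ext_concave \<phi>" by (simp add: ext_concave_def \<phi>_def)
  moreover have "f x = ext_exp (\<phi> x)" for x
    using *[THEN conjunct1, rule_format, of x] by (auto simp: \<phi>_def ext_exp_def)
  ultimately show "log_concave f" unfolding log_concave_def by blast
qed

lemma log_concave_nonneg: "log_concave f \<Longrightarrow> 0 \<le> f x"
  by (simp add: log_concave_iff)

lemma log_concaveD:
  "log_concave f \<Longrightarrow> 0 < t \<Longrightarrow> t < 1 \<Longrightarrow>
    f x powr (1 - t) * f y powr t \<le> f ((1 - t) *\<^sub>R x + t *\<^sub>R y)"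
  by (simp add: log_concave_iff)

text \<open>The logarithm of the exponential factor is linear, so this factor contributes the same
  amount to both sides. Tilted densities can thus be treated as log-concave functions in their own
  right.\<close>

lemma log_concave_exp_mult:
  fixes f :: "'a::real_inner \<Rightarrow> real"
  assumes "log_concave f"
  shows "log_concave (\<lambda>x. exp (\<theta> \<bullet> x) * f x)"
  unfolding log_concave_iff
proof (intro conjI allI impI)
  fix x y :: 'a and t :: real
  assume t: "0 < t \<and> t < 1"
  have "(exp (\<theta> \<bullet> x) * f x) powr (1 - t) * (exp (\<theta> \<bullet> y) * f y) powr t =
      exp (\<theta> \<bullet> ((1 - t) *\<^sub>R x + t *\<^sub>R y)) * (f x powr (1 - t) * f y powr t)"
    using assms
    by (simp add: powr_mult log_concave_nonneg exp_powr_real inner_add_right exp_add mult_ac)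
  also have "\<dots> \<le> exp (\<theta> \<bullet> ((1 - t) *\<^sub>R x + t *\<^sub>R y)) * f ((1 - t) *\<^sub>R x + t *\<^sub>R y)"
    using log_concaveD[OF assms, of t x y] t by simp
  finally show "(exp (\<theta> \<bullet> x) * f x) powr (1 - t) * (exp (\<theta> \<bullet> y) * f y) powr t
    \<le> exp (\<theta> \<bullet> ((1 - t) *\<^sub>R x + t *\<^sub>R y)) * f ((1 - t) *\<^sub>R x + t *\<^sub>R y)" .
qed (simp add: assms log_concave_nonneg)

text \<open>A weighted geometric mean of two numbers that are at least \<open>c > 0\<close> is again
  at least \<open>c\<close>; for \<open>c \<le> 0\<close> the set is the whole space.\<close>

lemma log_concave_convex_superlevel:
  assumes "log_concave f"
  shows "convex {x. c \<le> f x}"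
  unfolding convex_alt
proof (clarify)
  fix x y and t :: real
  assume xy: "c \<le> f x" "c \<le> f y" and t: "0 \<le> t" "t \<le> 1"
  show "c \<le> f ((1 - t) *\<^sub>R x + t *\<^sub>R y)"
  proof (cases "t = 0 \<or> t = 1 \<or> c \<le> 0")
    case True
    then show ?thesis
      using xy log_concave_nonneg[OF assms, of "(1 - t) *\<^sub>R x + t *\<^sub>R y"] by auto
  next
    case False
    with t have t: "0 < t" "t < 1" and c: "0 < c" by auto
    have "c = c powr (1 - t) * c powr t"
      using c by (simp flip: powr_add)
    also have "\<dots> \<le> f x powr (1 - t) * f y powr t"
      using xy c t by (intro mult_mono powr_mono2) auto
    also have "\<dots> \<le> f ((1 - t) *\<^sub>R x + t *\<^sub>R y)"
      by (rule log_concaveD) fact+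
    finally show ?thesis .
  qed
qed

lemma log_concave_convex_support:
  assumes "log_concave f"
  shows "convex {x. 0 < f x}"
  unfolding convex_alt
proof (clarify)
  fix x y and t :: real
  assume xy: "0 < f x" "0 < f y" and t: "0 \<le> t" "t \<le> 1"
  have "(1 - t) *\<^sub>R x + t *\<^sub>R y \<in> {z. min (f x) (f y) \<le> f z}"
    using log_concave_convex_superlevel[OF assms, of "min (f x) (f y)"] t
    unfolding convex_alt by simp
  then show "0 < f ((1 - t) *\<^sub>R x + t *\<^sub>R y)"
    using xy by auto
qed

text \<open>On this open convex set \<open>- ln (f x)\<close> is a finite convex function, and
  convex functions on open subsets of a Euclidean space are continuous.\<close>

lemma log_concave_continuous_interior:
  fixes f :: "'a::euclidean_space \<Rightarrow> real"
  assumes "log_concave f"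
  shows "continuous_on (interior {x. 0 < f x}) f"
proof -
  define D where "D = interior {x. 0 < f x}"
  have D: "x \<in> D \<Longrightarrow> 0 < f x" for x using interior_subset unfolding D_def by blast
  have cD: "convex D" unfolding D_def
    by (intro convex_interior log_concave_convex_support assms)
  have "convex_on D (\<lambda>x. - ln (f x))"
  proof (rule convex_onI)
    fix t :: real and x y
    assume t: "0 < t" "t < 1" and xy: "x \<in> D" "y \<in> D"
    have "(1 - t) * ln (f x) + t * ln (f y) = ln (f x powr (1 - t) * f y powr t)"
      using D[OF xy(1)] D[OF xy(2)] by (simp add: ln_mult ln_powr)
    also have "\<dots> \<le> ln (f ((1 - t) *\<^sub>R x + t *\<^sub>R y))"
      using D[OF xy(1)] D[OF xy(2)] log_concaveD[OF assms t, of x y]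
      by (subst ln_le_cancel_iff) (auto intro: less_le_trans[rotated])
    finally show "- ln (f ((1 - t) *\<^sub>R x + t *\<^sub>R y)) \<le> (1 - t) * - ln (f x) + t * - ln (f y)"
      by simp
  qed (rule cD)
  then have "continuous_on D (\<lambda>x. - ln (f x))"
    by (intro convex_on_continuous) (simp add: D_def)
  then have "continuous_on D (\<lambda>x. exp (- (- ln (f x))))"
    by (rule continuous_on_exp[OF continuous_on_minus])
  moreover have "exp (- (- ln (f x))) = f x" if "x \<in> D" for x
    using D[OF that] by simp
  ultimately have "continuous_on D f"
    by (rule continuous_on_eq)
  then show ?thesis by (simp only: D_def)
qed

section \<open>Convex hulls of perturbed cross polytopes\<close>

text \<open>Otherwise a hyperplane with normal \<open>u\<close> separates \<open>x\<close> from the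
  hull, and \<open>u \<bullet> (y j - x)\<close> is positive for every \<open>j\<close>. For a
  signed basis vector pointing sufficiently against \<open>u\<close>, the unperturbed vertex
  contributes at most \<open>- \<rho> * norm u / DIM('a)\<close>, which the perturbation cannot
  outweigh.\<close>

lemma mem_convex_hull_perturbed_cross:
  fixes x :: "'a::euclidean_space"
  assumes "0 < \<rho>"
    and y: "\<And>j. j \<in> Basis \<union> uminus ` Basis \<Longrightarrow> dist (x + \<rho> *\<^sub>R j) (y j) \<le> \<rho> / DIM('a)"
  shows "x \<in> convex hull (y ` (Basis \<union> uminus ` Basis))"
proof (rule ccontr)
  let ?J = "Basis \<union> uminus ` Basis :: 'a set"
  assume "x \<notin> convex hull (y ` ?J)"
  moreover have "closed (convex hull (y ` ?J))"
    by (intro compact_imp_closed finite_imp_compact_convex_hull) auto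
  ultimately obtain u b where ub: "u \<bullet> x < b" "\<And>z. z \<in> convex hull (y ` ?J) \<Longrightarrow> b < u \<bullet> z"
    using separating_hyperplane_closed_point[of "convex hull (y ` ?J)" x] by auto
  have sep: "0 < u \<bullet> (y j - x)" if "j \<in> ?J" for j
    using ub(1) ub(2)[OF hull_inc, of "y j"] that by (auto simp: inner_diff_right)
  \<comment> \<open>Pigeonhole: the absolute values of the coordinates of \<open>u\<close> sum to at
    least \<open>norm u\<close>.\<close>
  obtain i :: 'a where i: "i \<in> Basis" "norm u / DIM('a) \<le> \<bar>u \<bullet> i\<bar>"
  proof (rule ccontr)
    assume "\<not> thesis"
    then have "\<And>i. i \<in> Basis \<Longrightarrow> \<bar>u \<bullet> i\<bar> < norm u / DIM('a)" using that by force
    then have "(\<Sum>i\<in>Basis. \<bar>u \<bullet> i\<bar>) < (\<Sum>i\<in>(Basis::'a set). norm u / DIM('a))"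
      by (intro sum_strict_mono) auto
    then show False using norm_le_l1[of u] by simp
  qed
  \<comment> \<open>The sign makes \<open>j\<close> point against \<open>u\<close>.\<close>
  define j where "j = (if u \<bullet> i > 0 then - i else i)"
  have j: "j \<in> ?J" "u \<bullet> j = - \<bar>u \<bullet> i\<bar>" using i by (auto simp: j_def)
  have "u \<bullet> (y j - x) = \<rho> * (u \<bullet> j) + u \<bullet> (y j - (x + \<rho> *\<^sub>R j))"
    by (simp add: inner_diff_right inner_add_right)
  also have "u \<bullet> (y j - (x + \<rho> *\<^sub>R j)) \<le> norm u * (\<rho> / DIM('a))"
    using y[OF j(1)]
    by (intro order_trans[OF norm_cauchy_schwarz] mult_left_mono)
      (simp_all add: dist_norm norm_minus_commute)
  also have "\<rho> * (u \<bullet> j) \<le> - (\<rho> * (norm u / DIM('a)))"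
    using i(2) j(2) mult_left_mono[OF i(2), of \<rho>] assms(1) by simp
  finally show False using sep[OF j(1)] by (simp add: mult_ac)
qed

section \<open>Tent functions and their integrals\<close>

definition tent :: "'a::metric_space \<Rightarrow> real \<Rightarrow> 'a \<Rightarrow> real" where
  "tent c r x = max 0 (r - dist c x)"

text \<open>The only consequence of weak convergence that is needed: the tents serve as continuous weights
  for averages over balls, so that the boundaries of the balls play no role.\<close>

definition tent_convergent :: "(nat \<Rightarrow> 'a::euclidean_space \<Rightarrow> real) \<Rightarrow> ('a \<Rightarrow> real) \<Rightarrow> bool" where
  "tent_convergent fn f \<longleftrightarrow> (\<forall>c r. 0 < r \<longrightarrow>
     (\<lambda>n. \<integral>\<^sup>+x. ennreal (tent c r x) * ennreal (fn n x) \<partial>lebesgue)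
       \<longlonglongrightarrow> (\<integral>\<^sup>+x. ennreal (tent c r x) * ennreal (f x) \<partial>lebesgue))"

lemma tent_nonneg [simp]: "0 \<le> tent c r x"
  by (simp add: tent_def)

lemma tent_eq_0 [simp]: "x \<notin> ball c r \<Longrightarrow> tent c r x = 0"
  by (simp add: tent_def)

lemma continuous_on_tent: "continuous_on S (tent c r)"
  unfolding tent_def by (intro continuous_intros)

lemma borel_measurable_tent [measurable]: "tent c r \<in> borel_measurable borel"
  by (intro borel_measurable_continuous_onI continuous_on_tent)

lemma measurable_lebesgue_of_borel:
  fixes h :: "'a::euclidean_space \<Rightarrow> 'b"
  assumes "h \<in> borel \<rightarrow>\<^sub>M N"
  shows "h \<in> lebesgue \<rightarrow>\<^sub>M N"
  by (rule measurable_completion) (simp add: assms)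

lemma borel_measurable_lebesgue_tent [measurable]:
  "tent c r \<in> borel_measurable (lebesgue :: 'a::euclidean_space measure)"
  by (rule measurable_lebesgue_of_borel) simp

lemma emeasure_lebesgue_ball_pos:
  fixes c :: "'a::euclidean_space"
  assumes "0 < r"
  shows "0 < emeasure lebesgue (ball c r)"
  using assms by (simp add: emeasure_ball)

text \<open>The tent is at least \<open>r / 2\<close> on the ball of half the radius, and at most
  \<open>r\<close> on the ball outside which it vanishes. Positivity and finiteness together let
  multiplication by this integral preserve strict inequalities in \<open>ennreal\<close>.\<close>

lemma tent_integral:
  fixes c :: "'a::euclidean_space"
  assumes "0 < r"
  shows "0 < (\<integral>\<^sup>+x. ennreal (tent c r x) \<partial>lebesgue)" "(\<integral>\<^sup>+x. ennreal (tent c r x) \<partial>lebesgue) < \<infinity>"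
proof -
  have "0 < ennreal (r / 2) * emeasure lebesgue (ball c (r / 2))"
    using assms emeasure_lebesgue_ball_pos[of "r / 2" c]
    by (simp add: ennreal_zero_less_mult_iff)
  also have "\<dots> = (\<integral>\<^sup>+x. ennreal (r / 2) * indicator (ball c (r / 2)) x \<partial>lebesgue)"
    by (simp add: nn_integral_cmult_indicator)
  also have "\<dots> \<le> (\<integral>\<^sup>+x. ennreal (tent c r x) \<partial>lebesgue)"
    by (intro nn_integral_mono) (auto simp: tent_def indicator_def intro!: ennreal_leI)
  finally show "0 < (\<integral>\<^sup>+x. ennreal (tent c r x) \<partial>lebesgue)" .
  have "(\<integral>\<^sup>+x. ennreal (tent c r x) \<partial>lebesgue) \<le> (\<integral>\<^sup>+x. ennreal r * indicator (ball c r) x \<partial>lebesgue)"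
    by (intro nn_integral_mono) (auto simp: tent_def indicator_def ennreal_neg intro!: ennreal_leI)
  also have "\<dots> = ennreal r * emeasure lebesgue (ball c r)"
    by (simp add: nn_integral_cmult_indicator)
  also have "\<dots> < \<infinity>"
    using emeasure_lborel_ball_finite[of c r] by (simp add: ennreal_mult_less_top)
  finally show "(\<integral>\<^sup>+x. ennreal (tent c r x) \<partial>lebesgue) < \<infinity>" .
qed

lemma tent_integral_mult_mono:
  fixes g :: "'a::euclidean_space \<Rightarrow> real"
  shows "(\<And>x. x \<in> ball c r \<Longrightarrow> g x \<le> m) \<Longrightarrow>
      (\<integral>\<^sup>+x. ennreal (tent c r x) * ennreal (g x) \<partial>lebesgue) \<le> ennreal m * (\<integral>\<^sup>+x. ennreal (tent c r x) \<partial>lebesgue)"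
    and "(\<And>x. x \<in> ball c r \<Longrightarrow> m \<le> g x) \<Longrightarrow>
      ennreal m * (\<integral>\<^sup>+x. ennreal (tent c r x) \<partial>lebesgue) \<le> (\<integral>\<^sup>+x. ennreal (tent c r x) * ennreal (g x) \<partial>lebesgue)"
proof -
  have eq: "ennreal m * (\<integral>\<^sup>+x. ennreal (tent c r x) \<partial>lebesgue) = (\<integral>\<^sup>+x. ennreal (tent c r x) * ennreal m \<partial>lebesgue)"
    by (simp add: nn_integral_multc mult.commute[of "ennreal m"])
  have le: "ennreal (tent c r x) * ennreal a \<le> ennreal (tent c r x) * ennreal b"
    if "x \<in> ball c r \<Longrightarrow> a \<le> b" for x and a b :: real
    using that by (cases "x \<in> ball c r") (auto intro!: mult_left_mono ennreal_leI)
  show "(\<And>x. x \<in> ball c r \<Longrightarrow> g x \<le> m) \<Longrightarrow>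
      (\<integral>\<^sup>+x. ennreal (tent c r x) * ennreal (g x) \<partial>lebesgue) \<le> ennreal m * (\<integral>\<^sup>+x. ennreal (tent c r x) \<partial>lebesgue)"
    unfolding eq by (intro nn_integral_mono le)
  show "(\<And>x. x \<in> ball c r \<Longrightarrow> m \<le> g x) \<Longrightarrow>
      ennreal m * (\<integral>\<^sup>+x. ennreal (tent c r x) \<partial>lebesgue) \<le> (\<integral>\<^sup>+x. ennreal (tent c r x) * ennreal (g x) \<partial>lebesgue)"
    unfolding eq by (intro nn_integral_mono le)
qed

lemma tent_integral_strict_mono:
  fixes c :: "'a::euclidean_space"
  assumes "0 < r" "0 \<le> a" "a < b"
  shows "ennreal a * (\<integral>\<^sup>+x. ennreal (tent c r x) \<partial>lebesgue) < ennreal b * (\<integral>\<^sup>+x. ennreal (tent c r x) \<partial>lebesgue)"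
  using assms tent_integral[OF assms(1), of c]
  by (intro ennreal_mult_strict_right_mono) (auto simp: ennreal_less_iff)

section \<open>From tent averages to pointwise bounds\<close>

text \<open>If \<open>fn n\<close> were at most \<open>m'\<close> on the whole ball, its tent
  integral would be at most \<open>m'\<close> times that of the tent, whereas the limit of these
  integrals is strictly larger.\<close>

lemma eventually_exists_gt:
  fixes fn :: "nat \<Rightarrow> 'a::euclidean_space \<Rightarrow> real"
  assumes conv: "tent_convergent fn f" and "0 < r" "0 \<le> m'" "m' < m"
    and f: "\<And>x. x \<in> ball c r \<Longrightarrow> m \<le> f x"
  shows "\<forall>\<^sub>F n in sequentially. \<exists>y\<in>ball c r. m' < fn n y"
proof -
  let ?T = "\<integral>\<^sup>+x. ennreal (tent c r x) \<partial>lebesgue"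
  have "ennreal m' * ?T < ennreal m * ?T"
    by (rule tent_integral_strict_mono) fact+
  also have "\<dots> \<le> (\<integral>\<^sup>+x. ennreal (tent c r x) * ennreal (f x) \<partial>lebesgue)"
    by (rule tent_integral_mult_mono(2)) (rule f)
  finally have "\<forall>\<^sub>F n in sequentially. ennreal m' * ?T < (\<integral>\<^sup>+x. ennreal (tent c r x) * ennreal (fn n x) \<partial>lebesgue)"
    by (rule order_tendstoD(1)[OF conv[unfolded tent_convergent_def, rule_format, OF \<open>0 < r\<close>]])
  then show ?thesis
  proof eventually_elim
    case (elim n)
    show ?case
    proof (rule ccontr)
      assume "\<not> ?case"
      then have "fn n x \<le> m'" if "x \<in> ball c r" for x using that by force
      then show False using tent_integral_mult_mono(1)[of c r "fn n" m'] elim by force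
    qed
  qed
qed

lemma eventually_exists_less:
  fixes fn :: "nat \<Rightarrow> 'a::euclidean_space \<Rightarrow> real"
  assumes conv: "tent_convergent fn f" and "0 < r" "0 \<le> M" "M < M'"
    and f: "\<And>x. x \<in> ball c r \<Longrightarrow> f x \<le> M"
  shows "\<forall>\<^sub>F n in sequentially. \<exists>y\<in>ball c r. fn n y < M'"
proof -
  let ?T = "\<integral>\<^sup>+x. ennreal (tent c r x) \<partial>lebesgue"
  have "(\<integral>\<^sup>+x. ennreal (tent c r x) * ennreal (f x) \<partial>lebesgue) \<le> ennreal M * ?T"
    by (rule tent_integral_mult_mono(1)) (rule f)
  also have "\<dots> < ennreal M' * ?T"
    by (rule tent_integral_strict_mono) fact+
  finally have "\<forall>\<^sub>F n in sequentially. (\<integral>\<^sup>+x. ennreal (tent c r x) * ennreal (fn n x) \<partial>lebesgue) < ennreal M' * ?T"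
    by (rule order_tendstoD(2)[OF conv[unfolded tent_convergent_def, rule_format, OF \<open>0 < r\<close>]])
  then show ?thesis
  proof eventually_elim
    case (elim n)
    show ?case
    proof (rule ccontr)
      assume "\<not> ?case"
      then have "M' \<le> fn n x" if "x \<in> ball c r" for x using that by force
      then show False using tent_integral_mult_mono(2)[of c r M' "fn n"] elim by force
    qed
  qed
qed

text \<open>For \<open>y\<close> near \<open>x\<close>, each of \<open>2 d\<close> small balls placed like the vertices of a cross polytope around
  \<open>x\<close> eventually contains a point of \<open>{z. m' < fn n z}\<close>, and \<open>y\<close> is in the convex hull of these points.\<close>

lemma eventually_ge_on_ball:
  fixes fn :: "nat \<Rightarrow> 'a::euclidean_space \<Rightarrow> real"
  assumes conv: "tent_convergent fn f" and lc: "\<And>n. log_concave (fn n)"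
    and "0 < R" "0 \<le> m'" "m' < m" and f: "\<And>y. y \<in> ball x R \<Longrightarrow> m \<le> f y"
  obtains r where "0 < r" "\<forall>\<^sub>F n in sequentially. \<forall>y\<in>ball x r. m' \<le> fn n y"
proof
  let ?J = "Basis \<union> uminus ` Basis :: 'a set"
  define \<rho> where "\<rho> = R / 2"
  \<comment> \<open>With \<open>2 * r = \<rho> / DIM('a)\<close>, moving \<open>y\<close> by less
    than \<open>r\<close> and each vertex by less than \<open>r\<close> stays within the tolerance
    of \<open>mem_convex_hull_perturbed_cross\<close>.\<close>
  define r where "r = \<rho> / (2 * DIM('a))"
  have d: "1 \<le> real DIM('a)" using DIM_positive[where 'a='a] by linarith
  have \<rho>: "0 < \<rho>" using \<open>0 < R\<close> by (simp add: \<rho>_def)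
  show r: "0 < r" using \<rho> by (simp add: r_def)
  have r_le: "r \<le> \<rho> / 2" "2 * r = \<rho> / DIM('a)"
    using \<rho> d by (auto simp: r_def field_simps)
  have "\<forall>\<^sub>F n in sequentially. \<exists>y\<in>ball (x + \<rho> *\<^sub>R j) r. m' < fn n y" if "j \<in> ?J" for j
  proof (rule eventually_exists_gt[OF conv r \<open>0 \<le> m'\<close> \<open>m' < m\<close>])
    fix y assume y: "y \<in> ball (x + \<rho> *\<^sub>R j) r"
    have "dist x (x + \<rho> *\<^sub>R j) = \<rho>" using that \<rho> by (auto simp: dist_norm)
    then have "dist x y < \<rho> + r" using y dist_triangle[of x y "x + \<rho> *\<^sub>R j"] by simp
    also have "\<dots> \<le> R" using r_le \<rho> by (simp add: \<rho>_def)
    finally show "m \<le> f y" using f by simp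
  qed
  then have "\<forall>\<^sub>F n in sequentially. \<forall>j\<in>?J. \<exists>y\<in>ball (x + \<rho> *\<^sub>R j) r. m' < fn n y"
    by (subst eventually_ball_finite_distrib) auto
  then show "\<forall>\<^sub>F n in sequentially. \<forall>y\<in>ball x r. m' \<le> fn n y"
  proof eventually_elim
    case (elim n)
    then obtain z where z: "\<And>j. j \<in> ?J \<Longrightarrow> z j \<in> ball (x + \<rho> *\<^sub>R j) r \<and> m' < fn n (z j)"
      by metis
    show ?case
    proof
      fix y assume y: "y \<in> ball x r"
      \<comment> \<open>The cross polytope is recentred at \<open>y\<close>, so the same points
        \<open>z j\<close> serve for all \<open>y\<close> in the ball.\<close>
      have "dist (y + \<rho> *\<^sub>R j) (z j) \<le> \<rho> / DIM('a)" if "j \<in> ?J" for j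
        using z[OF that] y dist_triangle[of "y + \<rho> *\<^sub>R j" "z j" "x + \<rho> *\<^sub>R j"] r_le
        by (simp add: dist_commute)
      then have "y \<in> convex hull (z ` ?J)"
        using \<rho> by (intro mem_convex_hull_perturbed_cross) auto
      also have "\<dots> \<subseteq> {y. m' \<le> fn n y}"
        using z by (intro hull_minimal log_concave_convex_superlevel lc) (auto simp: less_imp_le)
      finally show "m' \<le> fn n y" by simp
    qed
  qed
qed

text \<open>The homothety with centre \<open>y\<close> and ratio \<open>t\<close> maps
  \<open>ball z0 r\<close> onto the ball containing \<open>p\<close>. So \<open>p\<close> lies on a
  segment from \<open>y\<close> to some \<open>z\<close> in \<open>ball z0 r\<close>, and
  log-concavity along it applies.\<close>

lemma log_concave_shrink_ball:
  fixes g :: "'a::real_normed_vector \<Rightarrow> real"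
  assumes "log_concave g" "0 < t" "t < 1" "0 \<le> m"
    and g: "\<And>z. z \<in> ball z0 r \<Longrightarrow> m \<le> g z" and p: "p \<in> ball ((1 - t) *\<^sub>R y + t *\<^sub>R z0) (t * r)"
  shows "g y powr (1 - t) * m powr t \<le> g p"
proof -
  define z where "z = z0 + (1 / t) *\<^sub>R (p - ((1 - t) *\<^sub>R y + t *\<^sub>R z0))"
  have "dist z0 z = dist ((1 - t) *\<^sub>R y + t *\<^sub>R z0) p / t"
    using \<open>0 < t\<close> by (simp add: z_def dist_norm norm_minus_commute)
  then have "z \<in> ball z0 r"
    using p \<open>0 < t\<close> by (simp add: pos_divide_less_eq mult.commute)
  moreover have "p = (1 - t) *\<^sub>R y + t *\<^sub>R z"
    using \<open>0 < t\<close> by (simp add: z_def algebra_simps)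
  moreover have "g y powr (1 - t) * g z powr t \<le> g ((1 - t) *\<^sub>R y + t *\<^sub>R z)"
    by (rule log_concaveD) fact+
  moreover have "g y powr (1 - t) * m powr t \<le> g y powr (1 - t) * g z powr t"
    using \<open>0 < t\<close> \<open>0 \<le> m\<close> g[OF \<open>z \<in> ball z0 r\<close>] by (intro mult_left_mono powr_mono2) auto
  ultimately show ?thesis by simp
qed

text \<open>Tent convergence yields only some point \<open>p\<close> of the contracted ball with
  \<open>fn n p < M'\<close>. Since \<open>log_concave_shrink_ball\<close> bounds
  \<open>fn n\<close> from below at every point of that ball in terms of \<open>fn n y\<close>, this
  limits the value at \<open>y\<close> itself.\<close>

lemma eventually_powr_mult_less:
  fixes fn :: "nat \<Rightarrow> 'a::euclidean_space \<Rightarrow> real"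
  assumes conv: "tent_convergent fn f" and lc: "\<And>n. log_concave (fn n)"
    and lower: "\<forall>\<^sub>F n in sequentially. \<forall>z\<in>ball z0 r. m \<le> fn n z"
    and "0 < r" "0 \<le> m" "0 < t" "t < 1" "0 \<le> M" "M < M'"
    and f: "\<And>p. p \<in> ball ((1 - t) *\<^sub>R y + t *\<^sub>R z0) (t * r) \<Longrightarrow> f p \<le> M"
  shows "\<forall>\<^sub>F n in sequentially. fn n y powr (1 - t) * m powr t < M'"
proof -
  have "\<forall>\<^sub>F n in sequentially. \<exists>p\<in>ball ((1 - t) *\<^sub>R y + t *\<^sub>R z0) (t * r). fn n p < M'"
    using assms by (intro eventually_exists_less[OF conv _ _ _ f]) auto
  with lower show ?thesis
    by eventually_elim
      (meson log_concave_shrink_ball[OF lc \<open>0 < t\<close> \<open>t < 1\<close> \<open>0 \<le> m\<close>] order.strict_trans1)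
qed

section \<open>Almost everywhere convergence of the densities\<close>

lemma continuous_at_interior_support:
  fixes f :: "'a::euclidean_space \<Rightarrow> real"
  assumes "log_concave f" "x \<in> interior {x. 0 < f x}"
  shows "isCont f x"
  using log_concave_continuous_interior[OF assms(1)] assms(2)
  by (simp add: continuous_on_eq_continuous_at)

lemma isCont_real_near:
  fixes f :: "'a::metric_space \<Rightarrow> real"
  assumes "isCont f x" "0 < \<epsilon>"
  obtains R where "0 < R" "\<And>y. y \<in> ball x R \<Longrightarrow> \<bar>f y - f x\<bar> < \<epsilon>"
  using assms by (force simp: continuous_at_eps_delta dist_real_def dist_commute)

text \<open>The lower bound is \<open>eventually_ge_on_ball\<close>. For the upper bound,
  contraction by 1/2 towards \<open>x\<close> itself gives
  \<open>sqrt (fn n x * (a - 2 * \<epsilon>)) < a + 2 * \<epsilon>\<close>, which is sharp as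
  \<open>\<epsilon>\<close> tends to 0.\<close>

lemma tendsto_interior_support:
  fixes fn :: "nat \<Rightarrow> 'a::euclidean_space \<Rightarrow> real"
  assumes conv: "tent_convergent fn f" and lcn: "\<And>n. log_concave (fn n)" and lc: "log_concave f"
    and x: "x \<in> interior {x. 0 < f x}"
  shows "(\<lambda>n. fn n x) \<longlonglongrightarrow> f x"
proof -
  define a where "a = f x"
  have a: "0 < a" using x interior_subset by (auto simp: a_def)
  have near: "\<exists>R>0. \<forall>y\<in>ball x R. a - \<epsilon> \<le> f y \<and> f y \<le> a + \<epsilon>" if \<epsilon>: "0 < \<epsilon>" for \<epsilon>
  proof -
    obtain R where R: "0 < R" "\<And>y. y \<in> ball x R \<Longrightarrow> \<bar>f y - a\<bar> < \<epsilon>"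
      using isCont_real_near[OF continuous_at_interior_support[OF lc x] \<epsilon>] unfolding a_def by blast
    have "a - \<epsilon> \<le> f y \<and> f y \<le> a + \<epsilon>" if "y \<in> ball x R" for y
      using R(2)[OF that] by linarith
    then show ?thesis using R(1) by blast
  qed
  have lower: "\<exists>r>0. \<forall>\<^sub>F n in sequentially. \<forall>y\<in>ball x r. a - 2 * \<epsilon> \<le> fn n y"
    if \<epsilon>: "0 < \<epsilon>" "2 * \<epsilon> < a" for \<epsilon>
  proof -
    obtain R where "0 < R" "\<And>y. y \<in> ball x R \<Longrightarrow> a - \<epsilon> \<le> f y" using near[OF \<epsilon>(1)] by blast
    then obtain r where "0 < r" "\<forall>\<^sub>F n in sequentially. \<forall>y\<in>ball x r. a - 2 * \<epsilon> \<le> fn n y"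
      using eventually_ge_on_ball[OF conv lcn, of R "a - 2 * \<epsilon>" "a - \<epsilon>" x] \<epsilon> by auto
    then show ?thesis by blast
  qed
  have "(\<lambda>n. fn n x) \<longlonglongrightarrow> a"
  proof (rule order_tendstoI)
    fix b assume b: "b < a"
    define \<epsilon> where "\<epsilon> = min (a / 4) ((a - b) / 4)"
    have \<epsilon>: "0 < \<epsilon>" "2 * \<epsilon> < a" "b < a - 2 * \<epsilon>" using a b by (auto simp: \<epsilon>_def min_def field_simps)
    obtain r where "0 < r" "\<forall>\<^sub>F n in sequentially. \<forall>y\<in>ball x r. a - 2 * \<epsilon> \<le> fn n y"
      using lower[OF \<epsilon>(1,2)] by blast
    from this(2) show "\<forall>\<^sub>F n in sequentially. b < fn n x"
    proof eventually_elim
      case (elim n)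
      then have "a - 2 * \<epsilon> \<le> fn n x" using \<open>0 < r\<close> by simp
      then show ?case using \<epsilon>(3) by linarith
    qed
  next
    fix b assume b: "a < b"
    \<comment> \<open>This quotient is the upper bound for \<open>fn n x\<close> reached below; its
      limit \<open>a\<close> is less than \<open>b\<close>, so a suitable \<open>\<epsilon>\<close>
      exists.\<close>
    have "((\<lambda>\<epsilon>. (a + 2 * \<epsilon>)\<^sup>2 / (a - 2 * \<epsilon>)) \<longlongrightarrow> (a + 2 * 0)\<^sup>2 / (a - 2 * 0)) (at_right 0)"
      using a by (intro tendsto_intros) auto
    then have "\<forall>\<^sub>F \<epsilon> in at_right 0. (a + 2 * \<epsilon>)\<^sup>2 / (a - 2 * \<epsilon>) < b"
      using a b by (intro order_tendstoD) (auto simp: power2_eq_square)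
    moreover have "\<forall>\<^sub>F \<epsilon> in at_right 0. \<epsilon> < a / 2"
      using a by (intro order_tendstoD) (auto intro: tendsto_ident_at)
    moreover have "\<forall>\<^sub>F \<epsilon> in at_right (0::real). 0 < \<epsilon>"
      by (rule eventually_at_right_less)
    ultimately have "\<forall>\<^sub>F \<epsilon> in at_right 0. 0 < \<epsilon> \<and> 2 * \<epsilon> < a \<and> (a + 2 * \<epsilon>)\<^sup>2 / (a - 2 * \<epsilon>) < b"
      by eventually_elim auto
    from eventually_happens'[OF trivial_limit_at_right_real this]
    obtain \<epsilon> where \<epsilon>: "0 < \<epsilon>" "2 * \<epsilon> < a" "(a + 2 * \<epsilon>)\<^sup>2 / (a - 2 * \<epsilon>) < b"
      by blast
    obtain r where r: "0 < r" "\<forall>\<^sub>F n in sequentially. \<forall>y\<in>ball x r. a - 2 * \<epsilon> \<le> fn n y"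
      using lower[OF \<epsilon>(1,2)] by blast
    obtain R where R: "0 < R" "\<And>y. y \<in> ball x R \<Longrightarrow> f y \<le> a + \<epsilon>" using near[OF \<epsilon>(1)] by blast
    have "\<forall>\<^sub>F n in sequentially. \<forall>y\<in>ball x (min r R). a - 2 * \<epsilon> \<le> fn n y"
      using r(2) by eventually_elim auto
    then have "\<forall>\<^sub>F n in sequentially. fn n x powr (1 - 1/2) * (a - 2 * \<epsilon>) powr (1/2) < a + 2 * \<epsilon>"
      by (rule eventually_powr_mult_less[OF conv lcn, where M = "a + \<epsilon>"])
        (use r R \<epsilon> a in \<open>auto simp flip: scaleR_left_distrib\<close>)
    then show "\<forall>\<^sub>F n in sequentially. fn n x < b"
    proof eventually_elim
      case (elim n)
      have "sqrt (fn n x * (a - 2 * \<epsilon>)) < a + 2 * \<epsilon>"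
        using elim \<epsilon> log_concave_nonneg[OF lcn, of n x] by (simp add: powr_half_sqrt real_sqrt_mult)
      then have "fn n x * (a - 2 * \<epsilon>) < (a + 2 * \<epsilon>)\<^sup>2"
        using a \<epsilon> real_sqrt_less_iff[of "fn n x * (a - 2 * \<epsilon>)" "(a + 2 * \<epsilon>)\<^sup>2"] by simp
      then have "fn n x < (a + 2 * \<epsilon>)\<^sup>2 / (a - 2 * \<epsilon>)"
        using \<epsilon> by (simp add: pos_less_divide_eq)
      then show ?case using \<epsilon>(3) by simp
    qed
  qed
  then show ?thesis by (simp add: a_def)
qed

text \<open>By continuity \<open>f\<close> is at least \<open>f x / 2\<close> near \<open>x\<close>,
  so \<open>f x / 4\<close> works for \<open>fn n\<close> on a smaller ball. This ball is the anchor
  of the later log-concavity arguments.\<close>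

lemma eventually_pos_ball:
  fixes fn :: "nat \<Rightarrow> 'a::euclidean_space \<Rightarrow> real"
  assumes conv: "tent_convergent fn f" and lcn: "\<And>n. log_concave (fn n)" and lc: "log_concave f"
    and x: "x \<in> interior {x. 0 < f x}"
  obtains r m where "0 < r" "0 < m" "\<forall>\<^sub>F n in sequentially. \<forall>y\<in>ball x r. m \<le> fn n y"
proof -
  have a: "0 < f x" using x interior_subset by auto
  obtain R where R: "0 < R" "\<And>y. y \<in> ball x R \<Longrightarrow> \<bar>f y - f x\<bar> < f x / 2"
    using isCont_real_near[OF continuous_at_interior_support[OF lc x] half_gt_zero[OF a]] by blast
  have "f x / 2 \<le> f y" if "y \<in> ball x R" for y
    using R(2)[OF that] by linarith
  from eventually_ge_on_ball[OF conv lcn \<open>0 < R\<close> _ _ this, of "f x / 4"]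
  obtain r where "0 < r" "\<forall>\<^sub>F n in sequentially. \<forall>y\<in>ball x r. f x / 4 \<le> fn n y"
    using a by auto
  then show thesis using that[of r "f x / 4"] a by simp
qed

text \<open>A contraction centred at \<open>x\<close> with small ratio moves an anchor ball into the
  region near \<open>x\<close> where \<open>f\<close> vanishes. There \<open>fn n\<close> takes
  arbitrarily small values, which forces \<open>fn n x\<close> to be small.\<close>

lemma tendsto_outside_support:
  fixes fn :: "nat \<Rightarrow> 'a::euclidean_space \<Rightarrow> real"
  assumes conv: "tent_convergent fn f" and lcn: "\<And>n. log_concave (fn n)" and lc: "log_concave f"
    and ne: "interior {x. 0 < f x} \<noteq> {}" and x: "x \<notin> closure {x. 0 < f x}"
  shows "(\<lambda>n. fn n x) \<longlonglongrightarrow> f x"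
proof -
  have "x \<in> - closure {x. 0 < f x}" "open (- closure {x. 0 < f x})" using x by auto
  then obtain R where R: "0 < R" "ball x R \<subseteq> - closure {x. 0 < f x}"
    by (meson open_contains_ball)
  have zero: "f y = 0" if "y \<in> ball x R" for y
  proof -
    have "y \<notin> {x. 0 < f x}" using R(2) that closure_subset[of "{x. 0 < f x}"] by (meson ComplD in_mono)
    then show ?thesis using log_concave_nonneg[OF lc, of y] by simp
  qed
  obtain z where "z \<in> interior {x. 0 < f x}" using ne by blast
  from eventually_pos_ball[OF conv lcn lc this]
  obtain r m where r: "0 < r" "0 < m" "\<forall>\<^sub>F n in sequentially. \<forall>y\<in>ball z r. m \<le> fn n y" .
  define q where "q = dist x z + r"
  \<comment> \<open>Points of the contracted ball have distance less than \<open>t * q\<close> from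
    \<open>x\<close>, hence less than \<open>R\<close>; the 1/2 keeps \<open>t\<close> below
    1.\<close>
  define t where "t = min (1/2) (R / q)"
  have q: "0 < q" using r by (simp add: q_def add_nonneg_pos)
  then have t: "0 < t" "t < 1" "t * q \<le> R"
    using R q by (auto simp: t_def min_def field_simps)
  have "(\<lambda>n. fn n x) \<longlonglongrightarrow> 0"
  proof (rule order_tendstoI)
    fix b :: real assume "b < 0"
    then show "\<forall>\<^sub>F n in sequentially. b < fn n x"
      using log_concave_nonneg[OF lcn] by (intro always_eventually) (meson order.strict_trans2)
  next
    fix b :: real assume b: "0 < b"
    \<comment> \<open>The bound is chosen so that cancelling \<open>m powr t\<close> leaves exactly
      \<open>fn n x < b\<close>.\<close>
    have "\<forall>\<^sub>F n in sequentially. fn n x powr (1 - t) * m powr t < b powr (1 - t) * m powr t"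
    proof (rule eventually_powr_mult_less[OF conv lcn r(3), where M = 0])
      fix p assume p: "p \<in> ball ((1 - t) *\<^sub>R x + t *\<^sub>R z) (t * r)"
      have "x - ((1 - t) *\<^sub>R x + t *\<^sub>R z) = t *\<^sub>R (x - z)" by (simp add: algebra_simps)
      then have "dist x ((1 - t) *\<^sub>R x + t *\<^sub>R z) = t * dist x z"
        using t by (simp add: dist_norm)
      then have "dist x p < t * q"
        using p dist_triangle[of x p "(1 - t) *\<^sub>R x + t *\<^sub>R z"] by (simp add: q_def distrib_left)
      then show "f p \<le> 0" using t zero[of p] by simp
    qed (use r t b in auto)
    then show "\<forall>\<^sub>F n in sequentially. fn n x < b"
    proof eventually_elim
      case (elim n)
      then have "fn n x powr (1 - t) < b powr (1 - t)" using r by simp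
      then show ?case using t b log_concave_nonneg[OF lcn, of n x]
        by (meson linorder_not_less powr_mono2 less_imp_le diff_ge_0_iff_ge)
    qed
  qed
  then show ?thesis using zero[of x] R by simp
qed

text \<open>The two preceding cases miss only the frontier of the support, and the frontier of a
  convex set is a null set.\<close>

lemma AE_tendsto:
  fixes fn :: "nat \<Rightarrow> 'a::euclidean_space \<Rightarrow> real"
  assumes conv: "tent_convergent fn f" and lcn: "\<And>n. log_concave (fn n)" and lc: "log_concave f"
    and ne: "interior {x. 0 < f x} \<noteq> {}"
  shows "AE x in lebesgue. (\<lambda>n. fn n x) \<longlonglongrightarrow> f x"
proof (rule AE_I')
  show "frontier {x. 0 < f x} \<in> null_sets lebesgue"
    using negligible_convex_frontier[OF log_concave_convex_support[OF lc]]
    by (simp add: negligible_iff_null_sets)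
  show "{x \<in> space lebesgue. \<not> (\<lambda>n. fn n x) \<longlonglongrightarrow> f x} \<subseteq> frontier {x. 0 < f x}"
    using tendsto_interior_support[OF conv lcn lc] tendsto_outside_support[OF conv lcn lc ne]
    by (auto simp: frontier_def)
qed

section \<open>Uniform exponential envelopes\<close>

text \<open>The centre \<open>x0\<close> lies between \<open>y\<close> and a point \<open>z\<close>
  of the small ball on the opposite side. A huge value at \<open>y\<close>, together with
  \<open>\<delta>\<close> at \<open>z\<close>, would force a huge value at \<open>x0\<close>;
  solving for \<open>h y\<close> gives the bound.\<close>

lemma log_concave_bound_on_ball:
  fixes h :: "'a::real_normed_vector \<Rightarrow> real"
  assumes lc: "log_concave h" and "0 < r" "0 < R" "0 < \<delta>"
    and lower: "\<And>y. y \<in> ball x0 r \<Longrightarrow> \<delta> \<le> h y" and upper: "h x0 \<le> K" and y: "y \<in> ball x0 R"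
  shows "h y \<le> (K / \<delta> powr (R / (R + r))) powr ((R + r) / r)"
proof -
  define t where "t = r / (R + r)"
  have t: "0 < t" "t < 1" "1 - t = R / (R + r)" "1 / t = (R + r) / r"
    using \<open>0 < r\<close> \<open>0 < R\<close> by (auto simp: t_def field_simps)
  \<comment> \<open>The reflection of \<open>y\<close> in \<open>x0\<close>, scaled by
    \<open>r / R\<close> so as to land in \<open>ball x0 r\<close>; the weight \<open>t\<close>
    makes \<open>x0\<close> equal to \<open>(1 - t) *\<^sub>R z + t *\<^sub>R y\<close>.\<close>
  define z where "z = x0 - (r / R) *\<^sub>R (y - x0)"
  have "dist x0 z = r / R * dist x0 y"
    using \<open>0 < r\<close> \<open>0 < R\<close> by (simp add: z_def dist_norm norm_minus_commute)
  also have "\<dots> < r / R * R"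
    using y \<open>0 < r\<close> \<open>0 < R\<close> by (intro mult_strict_left_mono) auto
  finally have z: "\<delta> \<le> h z" using lower \<open>0 < R\<close> by simp
  have "(1 - t) * (r / R) = t" using \<open>0 < r\<close> \<open>0 < R\<close> by (simp add: t(3)) (simp add: t_def)
  then have "(1 - t) *\<^sub>R z = (1 - t) *\<^sub>R x0 - t *\<^sub>R (y - x0)"
    by (simp add: z_def scaleR_diff_right[of "1 - t"] del: scaleR_left_diff_distrib)
  then have eq: "(1 - t) *\<^sub>R z + t *\<^sub>R y = x0"
    by (simp add: algebra_simps)
  have "\<delta> powr (1 - t) * h y powr t \<le> h z powr (1 - t) * h y powr t"
    using z t \<open>0 < \<delta>\<close> by (intro mult_right_mono powr_mono2) auto
  also have "\<dots> \<le> h x0" using log_concaveD[OF lc t(1,2), of z y] by (simp add: eq)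
  also note upper
  finally have "h y powr t \<le> K / \<delta> powr (1 - t)"
    using \<open>0 < \<delta>\<close> by (simp add: pos_le_divide_eq mult.commute)
  then have "(h y powr t) powr (1 / t) \<le> (K / \<delta> powr (1 - t)) powr (1 / t)"
    using t(1) by (intro powr_mono2) auto
  moreover have "(h y powr t) powr (1 / t) = h y"
    using t(1) log_concave_nonneg[OF lc, of y] by (simp add: powr_powr)
  ultimately show ?thesis by (simp only: t(3,4))
qed

text \<open>Along a ray from \<open>x0\<close> the logarithm of \<open>h\<close> drops by at least 1
  over the first length \<open>L\<close>; by concavity it keeps falling at rate at least
  \<open>1 / L\<close>.\<close>

lemma log_concave_ray_bound:
  fixes h :: "'a::real_normed_vector \<Rightarrow> real"
  assumes lc: "log_concave h" and "0 < \<delta>" "0 < L" and lower: "\<delta> \<le> h x0"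
    and sphere: "\<And>y. dist x0 y = L \<Longrightarrow> h y \<le> \<delta> * exp (-1)" and x: "L \<le> dist x0 x"
  shows "h x \<le> \<delta> * exp (- (dist x0 x / L))"
proof (cases "dist x0 x = L")
  case True
  then show ?thesis using sphere[of x] \<open>0 < L\<close> by simp
next
  case False
  define s where "s = L / dist x0 x"
  have d: "0 < dist x0 x" using x \<open>0 < L\<close> by linarith
  then have s: "0 < s" "s < 1" "dist x0 x / L = 1 / s" using False x \<open>0 < L\<close> by (auto simp: s_def)
  have "x0 - ((1 - s) *\<^sub>R x0 + s *\<^sub>R x) = s *\<^sub>R (x0 - x)" by (simp add: algebra_simps)
  then have "dist x0 ((1 - s) *\<^sub>R x0 + s *\<^sub>R x) = L"
    using d s by (simp add: dist_norm) (simp add: s_def dist_norm)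
  note y = sphere[OF this]
  have "\<delta> powr (1 - s) * h x powr s \<le> h x0 powr (1 - s) * h x powr s"
    using lower s \<open>0 < \<delta>\<close> by (intro mult_right_mono powr_mono2) auto
  also have "\<dots> \<le> \<delta> * exp (-1)" using log_concaveD[OF lc s(1,2), of x0 x] y by linarith
  \<comment> \<open>The claimed bound at \<open>x\<close> is the value whose interpolation with
    \<open>\<delta>\<close> at \<open>x0\<close> is exactly \<open>\<delta> * exp (-1)\<close> on
    the sphere.\<close>
  also have "\<dots> = \<delta> powr (1 - s) * (\<delta> * exp (- (1 / s))) powr s"
    using s \<open>0 < \<delta>\<close> by (simp add: powr_mult exp_powr_real flip: powr_add mult.assoc)
  finally have "h x powr s \<le> (\<delta> * exp (- (1 / s))) powr s"
    using \<open>0 < \<delta>\<close> by simp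
  then have "h x \<le> \<delta> * exp (- (1 / s))"
    using s \<open>0 < \<delta>\<close> by (meson linorder_not_less powr_less_mono2 exp_gt_zero mult_pos_pos less_imp_le)
  then show ?thesis by (simp add: s(3))
qed

lemma emeasure_lebesgue_ball_center:
  fixes c :: "'a::euclidean_space"
  shows "emeasure lebesgue (ball c r) = emeasure lebesgue (ball (0::'a) r)"
  by (cases "0 \<le> r") (simp_all add: emeasure_ball ball_empty)

text \<open>Beyond some radius \<open>k\<close> the limit has little mass. The \<open>gn n\<close>
  are eventually uniformly bounded on \<open>ball x0 L\<close>, so dominated convergence passes this
  smallness to them on a bounded annulus. A large value on the sphere of radius \<open>L\<close>
  would put too much mass there, so \<open>log_concave_ray_bound\<close> applies.\<close>

lemma eventually_exp_envelope:
  fixes g :: "'a::euclidean_space \<Rightarrow> real" and gn :: "nat \<Rightarrow> 'a \<Rightarrow> real"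
  assumes lc: "\<And>n. log_concave (gn n)"
    and meas [measurable]: "\<And>n. gn n \<in> borel_measurable lebesgue" "g \<in> borel_measurable lebesgue"
    and lim: "AE x in lebesgue. (\<lambda>n. gn n x) \<longlonglongrightarrow> g x"
    and fin: "(\<integral>\<^sup>+x. ennreal (g x) \<partial>lebesgue) < \<infinity>"
    and "0 < r" "0 < \<delta>" and lower: "\<forall>\<^sub>F n in sequentially. \<forall>y\<in>ball x0 r. \<delta> \<le> gn n y"
    and upper: "\<forall>\<^sub>F n in sequentially. gn n x0 \<le> K"
  obtains C c where "0 < c" "\<forall>\<^sub>F n in sequentially. \<forall>x. gn n x \<le> C * exp (- (c * dist x0 x))"
proof -
  define \<delta>' where "\<delta>' = \<delta> * exp (-1)"
  have \<delta>': "0 < \<delta>'" "\<delta>' \<le> \<delta>" using \<open>0 < \<delta>\<close> by (auto simp: \<delta>'_def)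
  \<comment> \<open>The mass of the constant \<open>\<delta>'\<close> on a ball of radius
    \<open>r / 2\<close>: the amount that a large value on the sphere would produce.\<close>
  define \<epsilon> where "\<epsilon> = ennreal \<delta>' * emeasure lebesgue (ball (0::'a) (r / 2))"
  have \<epsilon>: "0 < \<epsilon>"
    using \<delta>' \<open>0 < r\<close> emeasure_lebesgue_ball_pos[of "r / 2" "0::'a"]
    by (simp add: \<epsilon>_def ennreal_zero_less_mult_iff)
  have [measurable]: "{x. real k \<le> dist x0 x} \<in> sets lebesgue" for k
    by auto
  have "(\<lambda>k::nat. \<integral>\<^sup>+x. ennreal (g x) * indicator {x. k \<le> dist x0 x} x \<partial>lebesgue) \<longlonglongrightarrow> (\<integral>\<^sup>+x. 0 \<partial>(lebesgue :: 'a measure))"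
  proof (rule nn_integral_dominated_convergence[OF _ _ _ _ fin])
    show "AE x in lebesgue. (\<lambda>k::nat. ennreal (g x) * indicator {x. k \<le> dist x0 x} x) \<longlonglongrightarrow> 0"
    proof (rule AE_I2, rule tendsto_eventually)
      fix x
      obtain N :: nat where "dist x0 x < N" using reals_Archimedean2 by blast
      then show "\<forall>\<^sub>F k::nat in sequentially. ennreal (g x) * indicator {x. k \<le> dist x0 x} x = 0"
        by (intro eventually_sequentiallyI[of N]) auto
    qed
    show "AE x in lebesgue. ennreal (g x) * indicator {x. real k \<le> dist x0 x} x \<le> ennreal (g x)" for k
      by (auto simp: indicator_def)
  qed auto
  then have "\<forall>\<^sub>F k::nat in sequentially. (\<integral>\<^sup>+x. ennreal (g x) * indicator {x. k \<le> dist x0 x} x \<partial>lebesgue) < \<epsilon>"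
    using \<epsilon> by (intro order_tendstoD(2)) auto
  then obtain k :: nat where k: "(\<integral>\<^sup>+x. ennreal (g x) * indicator {x. k \<le> dist x0 x} x \<partial>lebesgue) < \<epsilon>"
    using eventually_happens'[OF sequentially_bot] by blast
  \<comment> \<open>Halfway to the sphere of radius \<open>L\<close> the distance from
    \<open>x0\<close> is \<open>k + r\<close>, so a ball of radius \<open>r / 2\<close> around such
    a midpoint stays inside the annulus \<open>S\<close>.\<close>
  define L where "L = 2 * real k + 2 * r"
  have L: "0 < L" using \<open>0 < r\<close> by (simp add: L_def add_nonneg_pos)
  define B where "B = (K / \<delta> powr (L / (L + r))) powr ((L + r) / r)"
  have bound: "\<forall>\<^sub>F n in sequentially. \<forall>y\<in>ball x0 L. gn n y \<le> B"
    using lower upper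
  proof eventually_elim
    case (elim n)
    then show ?case
      unfolding B_def using log_concave_bound_on_ball[OF lc \<open>0 < r\<close> L \<open>0 < \<delta>\<close>] by blast
  qed
  define S where "S = {x. k \<le> dist x0 x \<and> dist x0 x < L}"
  have S [measurable]: "S \<in> sets lebesgue"
    by (auto simp: S_def)
  \<comment> \<open>The bound \<open>B\<close> is valid only from some index on; shifting by
    \<open>N\<close> makes the domination hold for all indices, and \<open>LIMSEQ_offset\<close>
    undoes the shift.\<close>
  obtain N where N: "\<And>n y. N \<le> n \<Longrightarrow> y \<in> ball x0 L \<Longrightarrow> gn n y \<le> B"
    using bound unfolding eventually_sequentially by blast
  have "(\<lambda>n. \<integral>\<^sup>+x. ennreal (gn (n + N) x) * indicator S x \<partial>lebesgue) \<longlonglongrightarrow> (\<integral>\<^sup>+x. ennreal (g x) * indicator S x \<partial>lebesgue)"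
  proof (rule nn_integral_dominated_convergence)
    have [measurable]: "ball x0 L \<in> sets lebesgue" by auto
    show "(\<lambda>x. ennreal B * indicator (ball x0 L) x) \<in> borel_measurable lebesgue" by measurable
    show "(\<integral>\<^sup>+x. ennreal B * indicator (ball x0 L) x \<partial>lebesgue) < \<infinity>"
      using emeasure_lborel_ball_finite[of x0 L]
      by (simp add: nn_integral_cmult_indicator ennreal_mult_less_top)
    show "AE x in lebesgue. ennreal (gn (j + N) x) * indicator S x \<le> ennreal B * indicator (ball x0 L) x" for j
      using N[of "j + N"] by (intro AE_I2) (auto simp: S_def indicator_def intro!: ennreal_leI)
    show "AE x in lebesgue. (\<lambda>n. ennreal (gn (n + N) x) * indicator S x) \<longlonglongrightarrow> ennreal (g x) * indicator S x"
      using lim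
    proof eventually_elim
      case (elim x)
      then have "(\<lambda>n. ennreal (gn (n + N) x)) \<longlonglongrightarrow> ennreal (g x)"
        by (intro tendsto_ennrealI LIMSEQ_ignore_initial_segment)
      then show ?case by (cases "x \<in> S") auto
    qed
  qed simp_all
  then have "(\<lambda>n. \<integral>\<^sup>+x. ennreal (gn n x) * indicator S x \<partial>lebesgue) \<longlonglongrightarrow> (\<integral>\<^sup>+x. ennreal (g x) * indicator S x \<partial>lebesgue)"
    by (rule LIMSEQ_offset)
  moreover have "(\<integral>\<^sup>+x. ennreal (g x) * indicator S x \<partial>lebesgue) < \<epsilon>"
    by (rule order.strict_trans1[OF nn_integral_mono k]) (auto simp: S_def indicator_def)
  ultimately have small: "\<forall>\<^sub>F n in sequentially. (\<integral>\<^sup>+x. ennreal (gn n x) * indicator S x \<partial>lebesgue) < \<epsilon>"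
    by (rule order_tendstoD(2))
  \<comment> \<open>The summand \<open>\<delta>\<close> covers the outside of
    \<open>ball x0 L\<close>; \<open>B * exp 1\<close> covers the inside, where the exponential is
    at least \<open>exp (-1)\<close>.\<close>
  have "\<forall>\<^sub>F n in sequentially. \<forall>x. gn n x \<le> (\<delta> + B * exp 1) * exp (- (1 / L * dist x0 x))"
    using small lower bound
  proof eventually_elim
    case (elim n)
    have sphere: "gn n y \<le> \<delta>'" if y: "dist x0 y = L" for y
    proof (rule ccontr)
      \<comment> \<open>Otherwise \<open>gn n\<close> is at least \<open>\<delta>'\<close> on a ball around the midpoint of \<open>x0\<close> and \<open>y\<close>, and this
        ball lies in the annulus \<open>S\<close>, where \<open>gn n\<close> has too little mass.\<close>
      assume "\<not> gn n y \<le> \<delta>'"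
      then have gy: "\<delta>' < gn n y" by simp
      define q where "q = (1 - 1/2) *\<^sub>R y + (1/2::real) *\<^sub>R x0"
      have low: "\<delta>' \<le> gn n p" if p: "p \<in> ball q (r / 2)" for p
      proof -
        have "\<delta>' = \<delta>' powr (1 - 1/2) * \<delta>' powr (1/2)"
          using \<delta>' by (simp flip: powr_add)
        also have "\<dots> \<le> gn n y powr (1 - 1/2) * \<delta>' powr (1/2)"
          using gy \<delta>' by (intro mult_right_mono powr_mono2) auto
        also have "\<dots> \<le> gn n p"
          using elim(2) \<delta>' p
          by (intro log_concave_shrink_ball[OF lc, where r = r and ?z0.0 = x0]) (auto simp: q_def intro: order_trans)
        finally show ?thesis .
      qed
      have "x0 - q = (1/2) *\<^sub>R (x0 - y)" by (simp add: q_def algebra_simps flip: scaleR_left_distrib)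
      then have "dist x0 q = L / 2" using y by (simp add: dist_norm)
      then have "p \<in> S" if "p \<in> ball q (r / 2)" for p
        using that dist_triangle[of x0 p q] dist_triangle[of x0 q p] \<open>0 < r\<close>
        by (simp add: S_def L_def dist_commute)
      then have "(\<integral>\<^sup>+x. ennreal \<delta>' * indicator (ball q (r / 2)) x \<partial>lebesgue)
          \<le> (\<integral>\<^sup>+x. ennreal (gn n x) * indicator S x \<partial>lebesgue)"
        using low by (intro nn_integral_mono) (auto simp: indicator_def intro!: ennreal_leI)
      moreover have "(\<integral>\<^sup>+x. ennreal \<delta>' * indicator (ball q (r / 2)) x \<partial>lebesgue) = \<epsilon>"
        unfolding \<epsilon>_def emeasure_lebesgue_ball_center[of q, symmetric]
        by (simp add: nn_integral_cmult_indicator)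
      ultimately show False using elim(1) by simp
    qed
    show ?case
    proof
      fix x
      have B: "0 \<le> B" by (simp add: B_def)
      show "gn n x \<le> (\<delta> + B * exp 1) * exp (- (1 / L * dist x0 x))"
      proof (cases "L \<le> dist x0 x")
        case True
        have "gn n x \<le> \<delta> * exp (- (dist x0 x / L))"
          using elim(2) \<open>0 < r\<close> True sphere
          by (intro log_concave_ray_bound[OF lc \<open>0 < \<delta>\<close> L]) (auto simp: \<delta>'_def)
        also have "\<dots> \<le> (\<delta> + B * exp 1) * exp (- (dist x0 x / L))"
          using B by (intro mult_right_mono) auto
        finally show ?thesis by simp
      next
        case False
        then have "gn n x \<le> B" using elim(3) by simp
        also have "\<dots> \<le> B * (exp 1 * exp (- (dist x0 x / L)))"
        proof -
          have "1 \<le> exp 1 * exp (- (dist x0 x / L))"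
            using False L by (simp flip: exp_add)
          from mult_left_mono[OF this B] show ?thesis by simp
        qed
        also have "\<dots> \<le> (\<delta> + B * exp 1) * exp (- (dist x0 x / L))"
          using \<open>0 < \<delta>\<close> by (simp add: distrib_right)
        finally show ?thesis by simp
      qed
    qed
  qed
  then show thesis using that[of "1 / L"] L by simp
qed

section \<open>Polynomial weights and dominated convergence\<close>

text \<open>With \<open>a = c / real N\<close>, the estimate
  \<open>a * (1 + u) \<le> exp (a * (1 + u))\<close> is raised to the power \<open>N\<close>. For
  \<open>N = 0\<close> the quotient is 0 by convention, but its power is 1.\<close>

lemma power_mult_exp_le:
  fixes c u :: real
  assumes "0 < c" "0 \<le> u"
  shows "(1 + u) ^ N * exp (- (c * u)) \<le> exp c / (c / real N) ^ N"
proof (cases "N = 0")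
  case True
  have "exp (- (c * u)) \<le> 1" "1 \<le> exp c" using assms by auto
  then show ?thesis using True by simp
next
  case False
  define a where "a = c / real N"
  have a: "0 < a" "real N * a = c" using assms False by (auto simp: a_def)
  have "a * (1 + u) \<le> exp (a * (1 + u))"
    using exp_ge_add_one_self[of "a * (1 + u)"] by linarith
  then have "1 + u \<le> exp (a * (1 + u)) / a"
    using a(1) by (simp add: pos_le_divide_eq mult.commute)
  then have "(1 + u) ^ N \<le> (exp (a * (1 + u)) / a) ^ N"
    using assms by (intro power_mono) auto
  also have "\<dots> = exp (c + c * u) / a ^ N"
    using a(2) by (simp add: power_divide distrib_left flip: exp_of_nat_mult)
  finally have "(1 + u) ^ N * exp (- (c * u)) \<le> exp (c + c * u) / a ^ N * exp (- (c * u))"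
    by (intro mult_right_mono) auto
  moreover have "exp (c + c * u) * exp (- (c * u)) = exp c" by (simp flip: exp_add)
  ultimately show ?thesis by (simp add: a_def)
qed

lemma nn_integral_inverse_1_plus_square:
  "(\<integral>\<^sup>+x. ennreal (inverse (1 + (x::real)\<^sup>2)) \<partial>lborel) < \<infinity>"
  using integrable_inverse_1_plus_square
  by (simp add: set_integrable_def integrable_iff_bounded)

text \<open>The integrand is dominated by a multiple of a product of one-dimensional Cauchy kernels,
  whose integral factorises over the coordinates.\<close>

lemma nn_integral_polynomial_exp_decay:
  fixes x0 :: "'a::euclidean_space"
  assumes "0 < c"
  shows "(\<integral>\<^sup>+x. ennreal ((1 + norm x) ^ k * exp (- (c * dist x0 x))) \<partial>lebesgue) < \<infinity>"
proof -
  let ?q = "\<lambda>x::'a. \<Prod>b\<in>Basis. inverse (1 + (x \<bullet> b)\<^sup>2)"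
  \<comment> \<open>The extra exponent \<open>2 * DIM('a)\<close> pays for the product of the
    denominators \<open>1 + (x \<bullet> b)\<^sup>2\<close>. In \<open>B\<close>, the power of
    \<open>1 + norm x0\<close> is the cost of moving the centre from 0 to \<open>x0\<close>.\<close>
  define N where "N = k + 2 * DIM('a)"
  define B where "B = (1 + norm x0) ^ N * (exp c / (c / real N) ^ N)"
  have B: "0 \<le> B" using assms by (simp add: B_def)
  have le: "(1 + norm x) ^ k * exp (- (c * dist x0 x)) \<le> B * ?q x" for x :: 'a
  proof -
    have "norm x \<le> norm x0 + dist x0 x"
      by (metis dist_norm dist_commute norm_triangle_sub)
    moreover have "0 \<le> norm x0 * dist x0 x" by simp
    ultimately have "1 + norm x \<le> 1 + norm x0 + dist x0 x + norm x0 * dist x0 x" by linarith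
    then have "1 + norm x \<le> (1 + norm x0) * (1 + dist x0 x)" by (simp add: algebra_simps)
    then have "(1 + norm x) ^ N \<le> ((1 + norm x0) * (1 + dist x0 x)) ^ N"
      by (intro power_mono) auto
    then have "(1 + norm x) ^ N * exp (- (c * dist x0 x))
        \<le> ((1 + norm x0) * (1 + dist x0 x)) ^ N * exp (- (c * dist x0 x))"
      by (rule mult_right_mono) simp
    also have "\<dots> = (1 + norm x0) ^ N * ((1 + dist x0 x) ^ N * exp (- (c * dist x0 x)))"
      by (simp add: power_mult_distrib)
    also have "\<dots> \<le> B"
      unfolding B_def by (intro mult_left_mono power_mult_exp_le assms) auto
    finally have 1: "(1 + norm x) ^ k * exp (- (c * dist x0 x)) * (1 + norm x) ^ (2 * DIM('a)) \<le> B"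
      by (simp add: N_def power_add mult_ac)
    have "(\<Prod>b\<in>Basis. 1 + (x \<bullet> b)\<^sup>2) \<le> (\<Prod>b\<in>(Basis::'a set). (1 + norm x)\<^sup>2)"
    proof (intro prod_mono conjI)
      fix b :: 'a assume "b \<in> Basis"
      then have "(x \<bullet> b)\<^sup>2 \<le> (norm x)\<^sup>2"
        using Basis_le_norm[of b x] by (metis abs_ge_zero power2_abs power_mono)
      then show "1 + (x \<bullet> b)\<^sup>2 \<le> (1 + norm x)\<^sup>2"
        by (simp add: power2_eq_square algebra_simps) (smt (verit) norm_ge_zero)
    qed auto
    then have 2: "(\<Prod>b\<in>Basis. 1 + (x \<bullet> b)\<^sup>2) \<le> (1 + norm x) ^ (2 * DIM('a))"
      by (simp add: power_mult)
    have pos: "0 < (\<Prod>b\<in>Basis. 1 + (x \<bullet> b)\<^sup>2)"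
      by (intro prod_pos) (simp add: add_pos_nonneg)
    have "(1 + norm x) ^ k * exp (- (c * dist x0 x)) * (\<Prod>b\<in>Basis. 1 + (x \<bullet> b)\<^sup>2) \<le> B"
      by (rule order_trans[OF mult_left_mono[OF 2] 1]) simp
    moreover have "?q x = inverse (\<Prod>b\<in>Basis. 1 + (x \<bullet> b)\<^sup>2)"
      using prod_inversef[of "\<lambda>b. 1 + (x \<bullet> b)\<^sup>2" Basis] by (simp add: o_def)
    ultimately show ?thesis
      using pos by (simp add: pos_le_divide_eq flip: divide_inverse)
  qed
  have "(\<integral>\<^sup>+x. ennreal ((1 + norm x) ^ k * exp (- (c * dist x0 x))) \<partial>lebesgue)
      \<le> (\<integral>\<^sup>+x. ennreal B * (\<Prod>b\<in>Basis. ennreal (inverse (1 + (x \<bullet> b)\<^sup>2))) \<partial>(lebesgue :: 'a measure))"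
    using B le by (intro nn_integral_mono) (simp add: prod_ennreal prod_nonneg flip: ennreal_mult)
  also have "\<dots> = ennreal B * (\<Prod>b\<in>(Basis :: 'a set). (\<integral>\<^sup>+x. ennreal (inverse (1 + (x::real)\<^sup>2)) \<partial>lborel))"
    unfolding nn_integral_completion
    by (subst nn_integral_cmult, measurable, subst nn_integral_lborel_prod) auto
  also have "\<dots> < \<infinity>"
    using nn_integral_inverse_1_plus_square
    by (simp add: ennreal_mult_less_top power_less_top_ennreal)
  finally show ?thesis .
qed

text \<open>Induction on the construction of the polynomial: because \<open>1 + norm x\<close> is at
  least 1, bounds with different exponents can be raised to a common one, and products add
  exponents.\<close>

lemma real_polynomial_function_growth:
  fixes p :: "'a::real_normed_vector \<Rightarrow> real"
  assumes "real_polynomial_function p"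
  obtains A k where "0 \<le> A" "\<And>x. \<bar>p x\<bar> \<le> A * (1 + norm x) ^ k"
  using assms
proof (induction arbitrary: thesis)
  case (linear h)
  then obtain K where K: "0 < K" "\<And>x. norm (h x) \<le> norm x * K"
    using bounded_linear.pos_bounded by blast
  show ?case
  proof (rule linear.prems)
    show "\<bar>h x\<bar> \<le> K * (1 + norm x) ^ 1" for x
      using K(1) K(2)[of x] by (simp add: distrib_left mult.commute)
  qed (use K in simp)
next
  case (const c)
  show ?case by (rule const[of "\<bar>c\<bar>" 0]) auto
next
  case (add p q)
  obtain A k where p: "0 \<le> A" "\<And>x. \<bar>p x\<bar> \<le> A * (1 + norm x) ^ k" using add.IH(1) by blast
  obtain B l where q: "0 \<le> B" "\<And>x. \<bar>q x\<bar> \<le> B * (1 + norm x) ^ l" using add.IH(2) by blast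
  show ?case
  proof (rule add.prems)
    fix x
    have "\<bar>p x + q x\<bar> \<le> A * (1 + norm x) ^ k + B * (1 + norm x) ^ l"
      using p(2)[of x] q(2)[of x] by linarith
    also have "\<dots> \<le> A * (1 + norm x) ^ (k + l) + B * (1 + norm x) ^ (k + l)"
      using p(1) q(1) by (intro add_mono mult_left_mono power_increasing) auto
    finally show "\<bar>p x + q x\<bar> \<le> (A + B) * (1 + norm x) ^ (k + l)" by (simp add: distrib_right)
  qed (use p q in auto)
next
  case (mult p q)
  obtain A k where p: "0 \<le> A" "\<And>x. \<bar>p x\<bar> \<le> A * (1 + norm x) ^ k" using mult.IH(1) by blast
  obtain B l where q: "0 \<le> B" "\<And>x. \<bar>q x\<bar> \<le> B * (1 + norm x) ^ l" using mult.IH(2) by blast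
  show ?case
  proof (rule mult.prems)
    fix x
    have "\<bar>p x\<bar> * \<bar>q x\<bar> \<le> (A * (1 + norm x) ^ k) * (B * (1 + norm x) ^ l)"
      using p q by (intro mult_mono) auto
    then show "\<bar>p x * q x\<bar> \<le> (A * B) * (1 + norm x) ^ (k + l)"
      by (simp add: abs_mult power_add mult_ac)
  qed (use p q in auto)
qed

text \<open>The limit inherits the envelope almost everywhere. For nonnegative functions the
  difference is at most the larger of the two, so the polynomial bound times this same envelope is
  an integrable majorant.\<close>

lemma tendsto_polynomial_weighted_L1:
  fixes g :: "'a::euclidean_space \<Rightarrow> real" and gn :: "nat \<Rightarrow> 'a \<Rightarrow> real"
  assumes [measurable]: "\<And>n. gn n \<in> borel_measurable lebesgue" "g \<in> borel_measurable lebesgue"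
    and nonneg: "\<And>n x. 0 \<le> gn n x" "\<And>x. 0 \<le> g x"
    and lim: "AE x in lebesgue. (\<lambda>n. gn n x) \<longlonglongrightarrow> g x"
    and "0 < c" and env: "\<forall>\<^sub>F n in sequentially. \<forall>x. gn n x \<le> C * exp (- (c * dist x0 x))"
    and p: "real_polynomial_function p"
  shows "(\<integral>\<^sup>+x. ennreal (\<bar>p x\<bar> * g x) \<partial>lebesgue) < \<infinity>"
    and "(\<lambda>n. \<integral>\<^sup>+x. ennreal (\<bar>p x\<bar> * \<bar>gn n x - g x\<bar>) \<partial>lebesgue) \<longlonglongrightarrow> 0"
proof -
  obtain A k where A: "0 \<le> A" "\<And>x. \<bar>p x\<bar> \<le> A * (1 + norm x) ^ k"
    using real_polynomial_function_growth[OF p] by blast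
  have "continuous_on UNIV p"
    using p by (simp add: continuous_on_eq_continuous_within continuous_real_polymonial_function)
  then have "p \<in> borel_measurable borel" by (rule borel_measurable_continuous_onI)
  then have [measurable]: "p \<in> borel_measurable lebesgue" by (rule measurable_lebesgue_of_borel)
  obtain N where N: "\<And>n x. N \<le> n \<Longrightarrow> gn n x \<le> C * exp (- (c * dist x0 x))"
    using env unfolding eventually_sequentially by blast
  \<comment> \<open>At \<open>x0\<close> the envelope equals \<open>C\<close> and dominates a
    nonnegative number.\<close>
  have "0 \<le> C" using N[of N x0] nonneg(1)[of N x0] by simp
  have g_le: "AE x in lebesgue. g x \<le> C * exp (- (c * dist x0 x))"
    using lim by eventually_elim (erule LIMSEQ_le_const2, use N in \<open>intro exI[of _ N] allI impI\<close>)
  define W where "W x = ennreal (A * C) * ennreal ((1 + norm x) ^ k * exp (- (c * dist x0 x)))" for x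
  have W: "ennreal (\<bar>p x\<bar> * b) \<le> W x" if "0 \<le> b" "b \<le> C * exp (- (c * dist x0 x))" for b x
  proof -
    have "\<bar>p x\<bar> * b \<le> (A * (1 + norm x) ^ k) * (C * exp (- (c * dist x0 x)))"
      using that A \<open>0 \<le> C\<close> by (intro mult_mono) auto
    then have "ennreal (\<bar>p x\<bar> * b) \<le> ennreal (A * C * ((1 + norm x) ^ k * exp (- (c * dist x0 x))))"
      by (intro ennreal_leI) (simp add: mult_ac)
    then show ?thesis using A(1) \<open>0 \<le> C\<close> by (simp add: W_def ennreal_mult)
  qed
  have [measurable]: "(\<lambda>x::'a. ennreal ((1 + norm x) ^ k * exp (- (c * dist x0 x)))) \<in> borel_measurable lebesgue"
    by (rule measurable_lebesgue_of_borel) simp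
  have W_meas: "W \<in> borel_measurable lebesgue" unfolding W_def by measurable
  have W_fin: "(\<integral>\<^sup>+x. W x \<partial>lebesgue) < \<infinity>"
    using nn_integral_polynomial_exp_decay[OF \<open>0 < c\<close>, of k x0]
    unfolding W_def by (subst nn_integral_cmult, measurable) (simp add: ennreal_mult_less_top)
  have "(\<integral>\<^sup>+x. ennreal (\<bar>p x\<bar> * g x) \<partial>lebesgue) \<le> (\<integral>\<^sup>+x. W x \<partial>lebesgue)"
    using g_le by (intro nn_integral_mono_AE) (auto elim!: eventually_mono intro: W nonneg)
  then show "(\<integral>\<^sup>+x. ennreal (\<bar>p x\<bar> * g x) \<partial>lebesgue) < \<infinity>"
    using W_fin by (rule order.strict_trans1)
  have "(\<lambda>n. \<integral>\<^sup>+x. ennreal (\<bar>p x\<bar> * \<bar>gn (n + N) x - g x\<bar>) \<partial>lebesgue) \<longlonglongrightarrow> (\<integral>\<^sup>+x. 0 \<partial>(lebesgue :: 'a measure))"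
  proof (rule nn_integral_dominated_convergence[OF _ _ W_meas _ W_fin])
    show "AE x in lebesgue. ennreal (\<bar>p x\<bar> * \<bar>gn (n + N) x - g x\<bar>) \<le> W x" for n
      using g_le
    proof eventually_elim
      case (elim x)
      show ?case
        using elim N[of "n + N" x] nonneg(1)[of "n + N" x] nonneg(2)[of x] by (intro W) auto
    qed
    show "AE x in lebesgue. (\<lambda>n. ennreal (\<bar>p x\<bar> * \<bar>gn (n + N) x - g x\<bar>)) \<longlonglongrightarrow> 0"
      using lim
    proof eventually_elim
      case (elim x)
      have "(\<lambda>n. ennreal (\<bar>p x\<bar> * \<bar>gn (n + N) x - g x\<bar>)) \<longlonglongrightarrow> ennreal (\<bar>p x\<bar> * \<bar>g x - g x\<bar>)"
        by (intro tendsto_intros tendsto_ennrealI LIMSEQ_ignore_initial_segment[OF elim])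
      then show ?case by simp
    qed
  qed auto
  then have "(\<lambda>n. \<integral>\<^sup>+x. ennreal (\<bar>p x\<bar> * \<bar>gn (n + N) x - g x\<bar>) \<partial>lebesgue) \<longlonglongrightarrow> 0"
    by simp
  then show "(\<lambda>n. \<integral>\<^sup>+x. ennreal (\<bar>p x\<bar> * \<bar>gn n x - g x\<bar>) \<partial>lebesgue) \<longlonglongrightarrow> 0"
    by (rule LIMSEQ_offset)
qed

section \<open>From measures to densities\<close>

text \<open>The measure with density \<open>f\<close> lives on the Lebesgue sets, \<open>P\<close>
  only on the Borel sets. The identity map pushes the former forward to \<open>P\<close>, after
  which the change of variables and density rules apply.\<close>

lemma nn_integral_lebesgue_density:
  fixes P :: "'a::euclidean_space measure"
  assumes sets: "sets P = sets borel" and dens: "lebesgue_density P f" and h: "h \<in> borel_measurable borel"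
  shows "(\<integral>\<^sup>+x. h x \<partial>P) = (\<integral>\<^sup>+x. ennreal (f x) * h x \<partial>lebesgue)"
proof -
  have f: "f \<in> borel_measurable lebesgue"
    using dens by (simp add: lebesgue_density_def)
  have id: "(\<lambda>x. x) \<in> density lebesgue (\<lambda>x. ennreal (f x)) \<rightarrow>\<^sub>M (borel :: 'a measure)"
    using measurable_lebesgue_of_borel[of "\<lambda>x::'a. x" borel] by simp
  have h': "h \<in> borel_measurable lebesgue"
    using h by (rule measurable_lebesgue_of_borel)
  have "P = distr (density lebesgue (\<lambda>x. ennreal (f x))) borel (\<lambda>x. x)"
  proof (rule measure_eqI)
    fix A assume "A \<in> sets P"
    then have A: "A \<in> sets borel" by (simp add: sets)
    then have "A \<in> sets lebesgue" by simp
    then show "emeasure P A = emeasure (distr (density lebesgue (\<lambda>x. ennreal (f x))) borel (\<lambda>x. x)) A"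
      using A dens f id by (simp add: emeasure_distr emeasure_density lebesgue_density_def)
  qed (simp add: sets)
  then have "(\<integral>\<^sup>+x. h x \<partial>P) = (\<integral>\<^sup>+x. h x \<partial>distr (density lebesgue (\<lambda>x. ennreal (f x))) borel (\<lambda>x. x))"
    by simp
  also have "\<dots> = (\<integral>\<^sup>+x. h x \<partial>density lebesgue (\<lambda>x. ennreal (f x)))"
    by (rule nn_integral_distr[OF id]) (use h in simp)
  also have "\<dots> = (\<integral>\<^sup>+x. ennreal (f x) * h x \<partial>lebesgue)"
    using f h' by (intro nn_integral_density) auto
  finally show ?thesis .
qed

text \<open>Tents are bounded and continuous, hence admissible test functions; their integrals are
  then rewritten through the densities.\<close>

lemma tent_convergent_of_converges_weakly:
  assumes P: "prob_space P" "sets P = sets borel" "lebesgue_density P f"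
    and Pn: "\<And>n. prob_space (Pn n)" "\<And>n. sets (Pn n) = sets borel" "\<And>n. lebesgue_density (Pn n) (fn n)"
    and conv: "converges_weakly Pn P"
  shows "tent_convergent fn f"
  unfolding tent_convergent_def
proof (intro allI impI)
  fix c :: 'a and r :: real
  assume "0 < r"
  have bd: "\<bar>tent c r x\<bar> \<le> r" for x using \<open>0 < r\<close> by (auto simp: tent_def)
  then have "bounded (range (tent c r))"
    by (auto simp: bounded_iff)
  then have lim: "(\<lambda>n. \<integral>x. tent c r x \<partial>Pn n) \<longlonglongrightarrow> (\<integral>x. tent c r x \<partial>P)"
    using conv continuous_on_tent unfolding converges_weakly_def by blast
  have eq: "ennreal (\<integral>x. tent c r x \<partial>Q) = (\<integral>\<^sup>+x. ennreal (tent c r x) * ennreal (q x) \<partial>lebesgue)"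
    if Q: "prob_space Q" "sets Q = sets borel" "lebesgue_density Q q" for Q :: "'a measure" and q
  proof -
    interpret prob_space Q by fact
    have m: "tent c r \<in> borel_measurable Q"
      using measurable_cong_sets[OF Q(2) refl] borel_measurable_tent by blast
    have "integrable Q (tent c r)"
      using bd m by (intro integrable_const_bound[of _ r]) auto
    then have "ennreal (\<integral>x. tent c r x \<partial>Q) = (\<integral>\<^sup>+x. ennreal (tent c r x) \<partial>Q)"
      by (simp add: nn_integral_eq_integral)
    also have "\<dots> = (\<integral>\<^sup>+x. ennreal (tent c r x) * ennreal (q x) \<partial>lebesgue)"
      by (subst nn_integral_lebesgue_density[OF Q(2,3)]) (auto simp: mult.commute)
    finally show ?thesis .
  qed
  show "(\<lambda>n. \<integral>\<^sup>+x. ennreal (tent c r x) * ennreal (fn n x) \<partial>lebesgue)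
    \<longlonglongrightarrow> (\<integral>\<^sup>+x. ennreal (tent c r x) * ennreal (f x) \<partial>lebesgue)"
    using tendsto_ennrealI[OF lim] by (simp add: eq[OF P] eq[OF Pn])
qed

text \<open>A convex set with empty interior is a null set, so otherwise the density would vanish
  almost everywhere and the total mass would be 0.\<close>

lemma interior_support_nonempty:
  fixes P :: "'a::euclidean_space measure"
  assumes "prob_space P" "sets P = sets borel" and lc: "lc_density P f"
  shows "interior {x. 0 < f x} \<noteq> {}"
proof
  assume "interior {x. 0 < f x} = {}"
  then have "{x. 0 < f x} \<in> null_sets lebesgue"
    using lc by (simp add: lc_density_def negligible_convex_interior[OF log_concave_convex_support]
        flip: negligible_iff_null_sets)
  then have "AE x in lebesgue. ennreal (f x) = 0"
    by (rule AE_I') (auto simp: ennreal_eq_0_iff)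
  then have "(\<integral>\<^sup>+x. ennreal (f x) * indicator UNIV x \<partial>lebesgue) = (\<integral>\<^sup>+x. 0 \<partial>(lebesgue :: 'a measure))"
    by (intro nn_integral_cong_AE) auto
  moreover have "emeasure P UNIV = (\<integral>\<^sup>+x. ennreal (f x) * indicator UNIV x \<partial>lebesgue)"
    using lc unfolding lc_density_def lebesgue_density_def by (metis sets.top space_borel)
  moreover have "emeasure P UNIV = 1"
    using prob_space.emeasure_space_1[OF assms(1)] sets_eq_imp_space_eq[OF assms(2)] by simp
  ultimately show False by simp
qed

section \<open>Exponential tilting: convergence on the moment set, divergence off it\<close>

theorem theorem2p3:
  fixes P :: "(real ^ 'd) measure" and Pn :: "nat \<Rightarrow> (real ^ 'd) measure"
    and f :: "real ^ 'd \<Rightarrow> real" and fn :: "nat \<Rightarrow> real ^ 'd \<Rightarrow> real"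
  assumes "P \<in> lc_measures" and "\<And>n. Pn n \<in> lc_measures"
    and "lc_density P f" and "\<And>n. lc_density (Pn n) (fn n)"
    and "converges_weakly Pn P"
  shows "(\<forall>\<theta> \<in> exp_moment_set P. \<forall>p :: real ^ 'd \<Rightarrow> real. real_polynomial_function p \<longrightarrow>
            (\<integral>\<^sup>+x. ennreal (exp (\<theta> \<bullet> x) * \<bar>p x\<bar> * f x) \<partial>lebesgue) < \<infinity> \<and>
            (\<lambda>n. \<integral>\<^sup>+x. ennreal (exp (\<theta> \<bullet> x) * \<bar>p x\<bar> * \<bar>fn n x - f x\<bar>) \<partial>lebesgue)
              \<longlonglongrightarrow> 0) \<and>
         (\<forall>\<theta>. \<theta> \<notin> exp_moment_set P \<longrightarrow>
            (\<lambda>n. \<integral>\<^sup>+x. ennreal (exp (\<theta> \<bullet> x) * fn n x) \<partial>lebesgue) \<longlonglongrightarrow> \<infinity>)"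
proof -
  have P: "prob_space P" "sets P = sets borel" "lebesgue_density P f" and lc: "log_concave f"
    using assms(1,3) by (auto simp: lc_measures_def lc_density_def)
  have Pn: "\<And>n. prob_space (Pn n)" "\<And>n. sets (Pn n) = sets borel" "\<And>n. lebesgue_density (Pn n) (fn n)"
    and lcn: "\<And>n. log_concave (fn n)"
    using assms(2,4) by (auto simp: lc_measures_def lc_density_def)
  have meas [measurable]: "f \<in> borel_measurable lebesgue" "\<And>n. fn n \<in> borel_measurable lebesgue"
    using P(3) Pn(3) by (auto simp: lebesgue_density_def)
  have exp_meas [measurable]: "(\<lambda>x. exp (\<theta> \<bullet> x)) \<in> borel_measurable lebesgue" for \<theta> :: "real ^ 'd"
    by (rule measurable_lebesgue_of_borel) simp
  have conv: "tent_convergent fn f"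
    by (rule tent_convergent_of_converges_weakly[OF P Pn assms(5)])
  have ne: "interior {x. 0 < f x} \<noteq> {}"
    by (rule interior_support_nonempty[OF P(1,2) assms(3)])
  then obtain x0 where x0: "x0 \<in> interior {x. 0 < f x}" by blast
  obtain r m where r: "0 < r" "0 < m" "\<forall>\<^sub>F n in sequentially. \<forall>y\<in>ball x0 r. m \<le> fn n y"
    using eventually_pos_ball[OF conv lcn lc x0] .
  have tilt_lim: "AE x in lebesgue. (\<lambda>n. exp (\<theta> \<bullet> x) * fn n x) \<longlonglongrightarrow> exp (\<theta> \<bullet> x) * f x" for \<theta>
    using AE_tendsto[OF conv lcn lc ne] by eventually_elim (intro tendsto_intros)
  have tilt_int: "(\<integral>\<^sup>+x. ennreal (exp (\<theta> \<bullet> x)) \<partial>P) = (\<integral>\<^sup>+x. ennreal (exp (\<theta> \<bullet> x) * f x) \<partial>lebesgue)" for \<theta>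
    by (subst nn_integral_lebesgue_density[OF P(2,3)])
      (simp_all add: ennreal_mult log_concave_nonneg[OF lc] mult.commute)
  have "(\<integral>\<^sup>+x. ennreal (exp (\<theta> \<bullet> x) * \<bar>p x\<bar> * f x) \<partial>lebesgue) < \<infinity> \<and>
      (\<lambda>n. \<integral>\<^sup>+x. ennreal (exp (\<theta> \<bullet> x) * \<bar>p x\<bar> * \<bar>fn n x - f x\<bar>) \<partial>lebesgue) \<longlonglongrightarrow> 0"
    if \<theta>: "\<theta> \<in> exp_moment_set P" and p: "real_polynomial_function p" for \<theta> p
  proof -
    let ?g = "\<lambda>x. exp (\<theta> \<bullet> x) * f x" and ?gn = "\<lambda>n x. exp (\<theta> \<bullet> x) * fn n x"
    have fin: "(\<integral>\<^sup>+x. ennreal (?g x) \<partial>lebesgue) < \<infinity>"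
      using \<theta> by (simp add: exp_moment_set_def tilt_int)
    \<comment> \<open>By Cauchy-Schwarz the tilt factor is at least
      \<open>exp (\<theta> \<bullet> x0 - norm \<theta> * r)\<close> on the anchor ball, so
      \<open>\<delta>\<close> is a lower bound for the tilted densities there.\<close>
    define \<delta> where "\<delta> = exp (\<theta> \<bullet> x0 - norm \<theta> * r) * m"
    have "0 < \<delta>" using r by (simp add: \<delta>_def)
    have lower: "\<forall>\<^sub>F n in sequentially. \<forall>y\<in>ball x0 r. \<delta> \<le> ?gn n y"
      using r(3)
    proof eventually_elim
      case (elim n)
      show ?case
      proof
        fix y assume y: "y \<in> ball x0 r"
        have "\<theta> \<bullet> x0 - \<theta> \<bullet> y \<le> norm \<theta> * norm (x0 - y)"
          unfolding inner_diff_right[symmetric] by (rule norm_cauchy_schwarz)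
        also have "\<dots> \<le> norm \<theta> * r"
          using y by (intro mult_left_mono) (auto simp: dist_norm)
        finally show "\<delta> \<le> exp (\<theta> \<bullet> y) * fn n y"
          unfolding \<delta>_def using elim y r(2) by (intro mult_mono) auto
      qed
    qed
    have "(\<lambda>n. ?gn n x0) \<longlonglongrightarrow> ?g x0"
      by (intro tendsto_intros tendsto_interior_support[OF conv lcn lc x0])
    then have "\<forall>\<^sub>F n in sequentially. ?gn n x0 < ?g x0 + 1"
      by (rule order_tendstoD) simp
    then have upper: "\<forall>\<^sub>F n in sequentially. ?gn n x0 \<le> ?g x0 + 1"
      by eventually_elim simp
    obtain C c where c: "0 < c" "\<forall>\<^sub>F n in sequentially. \<forall>x. ?gn n x \<le> C * exp (- (c * dist x0 x))"
      by (rule eventually_exp_envelope[OF log_concave_exp_mult[OF lcn] _ _ tilt_lim fin r(1) \<open>0 < \<delta>\<close> lower upper])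
        measurable
    have "(\<integral>\<^sup>+x. ennreal (\<bar>p x\<bar> * ?g x) \<partial>lebesgue) < \<infinity>"
      and "(\<lambda>n. \<integral>\<^sup>+x. ennreal (\<bar>p x\<bar> * \<bar>?gn n x - ?g x\<bar>) \<partial>lebesgue) \<longlonglongrightarrow> 0"
      using tendsto_polynomial_weighted_L1[OF _ _ _ _ tilt_lim c p]
      by (simp_all add: log_concave_nonneg[OF lc] log_concave_nonneg[OF lcn])
    moreover have "\<bar>p x\<bar> * ?g x = exp (\<theta> \<bullet> x) * \<bar>p x\<bar> * f x"
      and "\<bar>p x\<bar> * \<bar>?gn n x - ?g x\<bar> = exp (\<theta> \<bullet> x) * \<bar>p x\<bar> * \<bar>fn n x - f x\<bar>" for n x
      by (simp_all add: abs_mult flip: right_diff_distrib)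
    ultimately show ?thesis by simp
  qed
  moreover have "(\<lambda>n. \<integral>\<^sup>+x. ennreal (exp (\<theta> \<bullet> x) * fn n x) \<partial>lebesgue) \<longlonglongrightarrow> \<infinity>"
    if \<theta>: "\<theta> \<notin> exp_moment_set P" for \<theta>
  proof -
    let ?I = "\<lambda>n. \<integral>\<^sup>+x. ennreal (exp (\<theta> \<bullet> x) * fn n x) \<partial>lebesgue"
    have "AE x in lebesgue. liminf (\<lambda>n. ennreal (exp (\<theta> \<bullet> x) * fn n x)) = ennreal (exp (\<theta> \<bullet> x) * f x)"
      using tilt_lim[of \<theta>]
      by eventually_elim (intro lim_imp_Liminf tendsto_ennrealI sequentially_bot)
    then have "(\<integral>\<^sup>+x. liminf (\<lambda>n. ennreal (exp (\<theta> \<bullet> x) * fn n x)) \<partial>lebesgue)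
        = (\<integral>\<^sup>+x. ennreal (exp (\<theta> \<bullet> x) * f x) \<partial>lebesgue)"
      by (rule nn_integral_cong_AE)
    also have "\<dots> = \<infinity>"
      using \<theta> by (simp add: exp_moment_set_def tilt_int less_top[symmetric])
    finally have "(\<integral>\<^sup>+x. liminf (\<lambda>n. ennreal (exp (\<theta> \<bullet> x) * fn n x)) \<partial>lebesgue) = \<infinity>" .
    \<comment> \<open>Fatou's lemma; an infinite lower limit of the integrals also makes the upper
      limit infinite, which is convergence to infinity.\<close>
    moreover have "(\<integral>\<^sup>+x. liminf (\<lambda>n. ennreal (exp (\<theta> \<bullet> x) * fn n x)) \<partial>lebesgue) \<le> liminf ?I"
      by (rule nn_integral_liminf) measurable
    ultimately have "liminf ?I = \<infinity>" by (simp add: top_unique)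
    moreover have "liminf ?I \<le> limsup ?I" by (rule Liminf_le_Limsup) simp
    ultimately show ?thesis
      by (simp add: tendsto_iff_Liminf_eq_Limsup top_unique)
  qed
  ultimately show ?thesis by blast
qed

end
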